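(* Let $W$ be an equitant elliptic family of bisectors such that the real plane cubic $E_W$ is irreducible. Then the base $B_W$ is an irreducible (real) algebraic curve.
   Context: $V$ is a 3-dimensional $\mathbb C$-linear space with a hermitian form $\langle-,-\rangle$ (linear in the first argument) of signature $++-$; the same letter denotes a point of $\mathbb P_{\mathbb C}V$ and a representative in $V$. $\mathbb B=\{p\in\mathbb P_{\mathbb C}V\mid\langle p,p\rangle<0\}$. $\mathrm{Lin}_{\mathbb C}(V,V)$ is the space of $\mathbb C$-linear maps $V\to V$, $h^*$ is the adjoint of $h$, and $\langle-,v\rangle w$ denotes the map $x\mapsto\langle x,v\rangle w$. A family of bisectors is an $\mathbb R$-linear subspace $W\subset\mathrm{Lin}_{\mathbb C}(V,V)$ such that $\operatorname{tr}h=0$ and $h^*=h$ for all $h\in W$, $W$ is the $\mathbb R$-span of $D_W:=\{h\in W\mid\det h=0\}$, and $B_W\cap\mathbb B\ne\varnothing$, where $B_W:=\{p\in\mathbb P_{\mathbb C}V\mid\langle hp,p\rangle=0\text{ for all }h\in W\}$ is the base of the family, a real algebraic subset of $\mathbb P_{\mathbb C}V$ (regarded as a real algebraic variety). $E_W\subset\mathbb P_{\mathbb R}W$ is given by the equation $\det=0$. The family is elliptic if $\dim_{\mathbb R}W=3$ and $D_W\ne W$; then $E_W$ is a real plane cubic, and irreducible means that the cubic form $\det|_W$ is irreducible. Equitant families: let $p_1,\dots,p_4\in\mathbb P_{\mathbb C}V$ be points of a same signature $\sigma\in\{+1,-1,0\}$ (the sign of $\langle p_i,p_i\rangle$), no 3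 of them on a same complex projective line. Choose representatives $p_i\in V$ with $\langle p_i,p_i\rangle=\sigma$ and suppose that there is $p\in V$ with $\langle p,p\rangle<0$ and $|\langle p,p_i\rangle|=1$ for all $i$. Put $w_i:=\langle-,p_i\rangle p_i$. Then $W:=\{\sum_{i=1}^4r_iw_i\mid r_i\in\mathbb R,\ \sum_{i=1}^4r_i=0\}$ is an elliptic family of bisectors, called equitant from the $p_i$'s. An elliptic family is equitant if it arises in this way. *)

theory Defs
  imports "HOL-Analysis.Analysis"
begin

text \<open>
  The three-dimensional complex space \<open>V\<close> is coordinatised as \<open>complex ^ 3\<close> and carries an arbitrary
  hermitian form \<open>H\<close> of signature \<open>++-\<close>; complex-linear endomorphisms of \<open>V\<close> are matrices acting
  by \<open>*v\<close>. Unqualified \<open>subspace\<close>, \<open>span\<close>, \<open>dim\<close> are over the reals; the versions prefixed with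
  \<open>vec\<close> are over the complex numbers.
\<close>

type_synonym V = "complex ^ 3"
type_synonym endo = "complex ^ 3 ^ 3"

section \<open>Hermitian forms\<close>

definition hermitian_form :: "(V \<Rightarrow> V \<Rightarrow> complex) \<Rightarrow> bool" where
  "hermitian_form H \<longleftrightarrow>
     (\<forall>x y z. H (x + y) z = H x z + H y z) \<and>
     (\<forall>c x y. H (c *s x) y = c * H x y) \<and>
     (\<forall>x y. H y x = cnj (H x y))"

definition signature_ppm :: "(V \<Rightarrow> V \<Rightarrow> complex) \<Rightarrow> bool" where
  "signature_ppm H \<longleftrightarrow>
     (\<exists>e1 e2 e3. vec.span {e1, e2, e3} = UNIV \<and>
        H e1 e2 = 0 \<and> H e1 e3 = 0 \<and> H e2 e3 = 0 \<and>
        H e1 e1 = 1 \<and> H e2 e2 = 1 \<and> H e3 e3 = -1)"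

definition is_adjoint :: "(V \<Rightarrow> V \<Rightarrow> complex) \<Rightarrow> endo \<Rightarrow> endo \<Rightarrow> bool" where
  "is_adjoint H h g \<longleftrightarrow> (\<forall>x y. H (h *v x) y = H x (g *v y))"

section \<open>The complex projective plane as a real algebraic variety\<close>

text \<open>A point of the projective plane is a complex line through the origin, as a set of vectors.\<close>

definition proj_plane :: "V set set" where
  "proj_plane = {vec.span {v} | v. v \<noteq> 0}"

definition negative_ball :: "(V \<Rightarrow> V \<Rightarrow> complex) \<Rightarrow> V set set" where
  "negative_ball H = {L \<in> proj_plane. \<forall>p\<in>L. p \<noteq> 0 \<longrightarrow> Re (H p p) < 0}"

text \<open>
  A set of points is real algebraic if it is cut out by real polynomials in the real and imaginary
  parts of the homogeneous coordinates. The polynomials need not be homogeneous, since vanishing is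
  required on the whole line \<open>L\<close>. This is the same as being real algebraic in each
  of the three affine charts \<open>\<complex>\<^sup>2 = \<real>\<^sup>4\<close>: an equation \<open>f = 0\<close> in the chart \<open>x\<^sub>i \<noteq> 0\<close> becomes polynomial
  after multiplication by a power of \<open>|x\<^sub>i|\<^sup>2\<close>.
\<close>

definition real_algebraic :: "V set set \<Rightarrow> bool" where
  "real_algebraic S \<longleftrightarrow>
     (\<exists>F. (\<forall>f\<in>F. real_polynomial_function f) \<and>
          S = {L \<in> proj_plane. \<forall>p\<in>L. \<forall>f\<in>F. f p = 0})"

definition irreducible_algebraic :: "V set set \<Rightarrow> bool" where
  "irreducible_algebraic S \<longleftrightarrow>
     real_algebraic S \<and> S \<noteq> {} \<and>
     (\<forall>A B. real_algebraic A \<longrightarrow> real_algebraic B \<longrightarrow> S = A \<union> B \<longrightarrow> A = S \<or> B = S)"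

text \<open>
  The dimension is the Krull dimension of the Zariski topology on \<open>S\<close>, i.e. the supremum of the
  lengths of chains of irreducible algebraic subsets.
\<close>

definition algebraic_dim :: "V set set \<Rightarrow> enat" where
  "algebraic_dim S =
     Sup {enat n | n. \<exists>Z :: nat \<Rightarrow> V set set.
            (\<forall>i\<le>n. irreducible_algebraic (Z i) \<and> Z i \<subseteq> S) \<and> (\<forall>i<n. Z i \<subset> Z (Suc i))}"

definition irreducible_algebraic_curve :: "V set set \<Rightarrow> bool" where
  "irreducible_algebraic_curve S \<longleftrightarrow> irreducible_algebraic S \<and> algebraic_dim S = 1"

section \<open>Families of bisectors\<close>

definition degenerate_locus :: "endo set \<Rightarrow> endo set" where
  "degenerate_locus W = {h \<in> W. det h = 0}"

definition base :: "(V \<Rightarrow> V \<Rightarrow> complex) \<Rightarrow> endo set \<Rightarrow> V set set" where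
  "base H W = {L \<in> proj_plane. \<forall>p\<in>L. \<forall>h\<in>W. H (h *v p) p = 0}"

definition family_of_bisectors :: "(V \<Rightarrow> V \<Rightarrow> complex) \<Rightarrow> endo set \<Rightarrow> bool" where
  "family_of_bisectors H W \<longleftrightarrow>
     subspace W \<and>
     (\<forall>h\<in>W. trace h = 0 \<and> is_adjoint H h h) \<and>
     W = span (degenerate_locus W) \<and>
     base H W \<inter> negative_ball H \<noteq> {}"

definition elliptic_family :: "(V \<Rightarrow> V \<Rightarrow> complex) \<Rightarrow> endo set \<Rightarrow> bool" where
  "elliptic_family H W \<longleftrightarrow>
     family_of_bisectors H W \<and> dim W = 3 \<and> degenerate_locus W \<noteq> W"

text \<open>
  Irreducibility of \<open>F\<close> in the ring \<open>\<real>[W]\<close> of real polynomial functions on \<open>W\<close>, these being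
  the restrictions to \<open>W\<close> of polynomial functions on the ambient space; the units of \<open>\<real>[W]\<close> are the
  nonzero constants.
\<close>

definition irreducible_polynomial_on :: "endo set \<Rightarrow> (endo \<Rightarrow> real) \<Rightarrow> bool" where
  "irreducible_polynomial_on W F \<longleftrightarrow>
     (\<exists>f. real_polynomial_function f \<and> (\<forall>h\<in>W. F h = f h)) \<and>
     \<not> (\<exists>c. \<forall>h\<in>W. F h = c) \<and>
     (\<forall>f g. real_polynomial_function f \<longrightarrow> real_polynomial_function g \<longrightarrow>
        (\<forall>h\<in>W. F h = f h * g h) \<longrightarrow>
        (\<exists>c. \<forall>h\<in>W. f h = c) \<or> (\<exists>c. \<forall>h\<in>W. g h = c))"

text \<open>For self-adjoint \<open>h\<close> the determinant is real, so \<open>Re\<close> only changes its type.\<close>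

definition irreducible_cubic :: "endo set \<Rightarrow> bool" where
  "irreducible_cubic W \<longleftrightarrow> irreducible_polynomial_on W (\<lambda>h. Re (det h))"

section \<open>Equitant families\<close>

definition rank_one :: "(V \<Rightarrow> V \<Rightarrow> complex) \<Rightarrow> V \<Rightarrow> V \<Rightarrow> endo" where
  "rank_one H v w = matrix (\<lambda>x. H x v *s w)"

definition equitant_family :: "(V \<Rightarrow> V \<Rightarrow> complex) \<Rightarrow> endo set \<Rightarrow> bool" where
  "equitant_family H W \<longleftrightarrow>
     (\<exists>(p :: 4 \<Rightarrow> V) (\<sigma> :: real).
        \<sigma> \<in> {1, -1, 0} \<and>
        (\<forall>i. p i \<noteq> 0 \<and> H (p i) (p i) = of_real \<sigma>) \<and>
        (\<forall>i j k. i \<noteq> j \<longrightarrow> i \<noteq> k \<longrightarrow> j \<noteq> k \<longrightarrow>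
           \<not> (\<exists>U. vec.subspace U \<and> vec.dim U = 2 \<and> {p i, p j, p k} \<subseteq> U)) \<and>
        (\<exists>q. Re (H q q) < 0 \<and> (\<forall>i. cmod (H q (p i)) = 1)) \<and>
        W = {\<Sum>i\<in>UNIV. r i *\<^sub>R rank_one H (p i) (p i) | r. (\<Sum>i\<in>UNIV. r i) = 0})"

end

theory Submission imports Defs begin

text \<open>
  Rescaling the four points by phases, their linear relation becomes \<open>a P1 + b P2 + c P3 + d P4 = 0\<close> with
  positive reals \<open>a, b, c, d\<close>. The base consists of the \<open>x\<close> whose four products with the points have
  the same modulus, so it is the configuration space of planar quadrilaterals with sides \<open>a, b, c, d\<close>:
  the pairs of unit numbers \<open>u, v\<close> with \<open>|a u + b v + c| = d\<close>. This is the real part of a curve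
  quadratic in \<open>u\<close> over \<open>\<complex>[v]\<close>, whose discriminant is a product of two quadratics in \<open>v\<close> without
  common root. It is a square only if the sides form two pairs of equal ones, and in that case the cubic
  factors. Otherwise a real polynomial that does not vanish identically on the base has a
  nonzero norm in \<open>\<complex>(v)\<close>, hence finitely many zeros. Finally, the base is infinite: it would be finite
  only if one side were the sum of the others, which strict convexity of a sphere in the positive
  definite space orthogonal to \<open>q\<close> excludes.
\<close>

section \<open>Linkages with four bars\<close>

text \<open>Compare orders of vanishing at \<open>z\<close>: even on the left, \<open>1\<close> plus
  an even number on the right. The factor \<open>P * P\<close> allows denominators, so
  \<open>D\<close> is not a square in the field of rational functions either.\<close>

lemma square_neq_simple_root:
  fixes D P R :: "complex poly"
  assumes "poly D z = 0" "poly (pderiv D) z \<noteq> 0" "P \<noteq> 0"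
  shows "R * R \<noteq> D * (P * P)"
proof
  assume eq: "R * R = D * (P * P)"
  have D0: "D \<noteq> 0" "pderiv D \<noteq> 0"
    using assms by auto
  then have "order z D = 1"
    using assms order_pderiv[of D z] by (simp add: order_root)
  moreover have "R \<noteq> 0"
    using eq D0 \<open>P \<noteq> 0\<close> by auto
  ultimately have "2 * order z R = 1 + 2 * order z P"
    using arg_cong[OF eq, of "order z"] D0 \<open>P \<noteq> 0\<close> by (simp add: order_mult)
  then show False by presburger
qed

text \<open>Otherwise the first quadratic has a simple root \<open>z\<close>, which is nonzero
  because \<open>k\<close> is. The quadratics differ by \<open>(\<beta> - \<alpha>) * z\<close>
  there, so the second does not vanish and \<open>z\<close> is a simple root of the product.\<close>

lemma palindromic_quadratics_square:
  fixes P R :: "complex poly" and k \<alpha> \<beta> :: complex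
  assumes "k \<noteq> 0" "\<alpha> \<noteq> \<beta>" "P \<noteq> 0" "R * R = ([:k, \<alpha>, k:] * [:k, \<beta>, k:]) * (P * P)"
  shows "\<alpha>\<^sup>2 = 4 * k\<^sup>2"
proof (rule ccontr)
  assume ne: "\<alpha>\<^sup>2 \<noteq> 4 * k\<^sup>2"
  \<comment> \<open>\<open>s\<close> is a square root of the discriminant and \<open>z\<close> the
    corresponding root; \<open>s\<close> is also the derivative at \<open>z\<close>, hence the
    simplicity.\<close>
  define s where "s = csqrt (\<alpha>\<^sup>2 - 4 * k\<^sup>2)"
  define z where "z = (s - \<alpha>) / (2 * k)"
  have s2: "s\<^sup>2 = \<alpha>\<^sup>2 - 4 * k\<^sup>2" and "s \<noteq> 0"
    using ne by (auto simp: s_def)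
  have s: "s = 2 * k * z + \<alpha>"
    using \<open>k \<noteq> 0\<close> by (simp add: z_def)
  have "4 * k * (k + \<alpha> * z + k * z\<^sup>2) = 0"
    using s2 unfolding s by (simp add: algebra_simps power2_eq_square)
  then have root: "k + \<alpha> * z + k * z\<^sup>2 = 0"
    using \<open>k \<noteq> 0\<close> by simp
  have "z \<noteq> 0"
    using root \<open>k \<noteq> 0\<close> by auto
  have q1: "poly [:k, \<alpha>, k:] z = 0"
    using root by (simp add: algebra_simps power2_eq_square)
  have "poly [:k, \<beta>, k:] z = (k + \<alpha> * z + k * z\<^sup>2) + (\<beta> - \<alpha>) * z"
    by (simp add: algebra_simps power2_eq_square)
  then have q2: "poly [:k, \<beta>, k:] z \<noteq> 0"
    using root \<open>z \<noteq> 0\<close> \<open>\<alpha> \<noteq> \<beta>\<close> by simp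
  have "poly (pderiv [:k, \<alpha>, k:]) z = s"
    by (simp add: s pderiv_pCons algebra_simps)
  then have "poly (pderiv ([:k, \<alpha>, k:] * [:k, \<beta>, k:])) z \<noteq> 0"
    using q1 q2 \<open>s \<noteq> 0\<close> by (simp only: pderiv_mult poly_add poly_mult) simp
  moreover have "poly ([:k, \<alpha>, k:] * [:k, \<beta>, k:]) z = 0"
    using q1 by (simp only: poly_mult) simp
  ultimately show False
    using square_neq_simple_root assms by blast
qed

section \<open>The quadratic relation of the linkage and its discriminant\<close>

locale quadrilateral =
  fixes a b c d :: real
  assumes pos: "a > 0" "b > 0" "c > 0" "d > 0"
begin

definition linkage :: "(complex \<times> complex) set" where
  "linkage = {(u, v). norm u = 1 \<and> norm v = 1 \<and> norm (a * u + b * v + c) = d}"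

text \<open>With \<open>middle\<close> and \<open>last_coeff\<close>, the coefficients of
  \<open>u\<^sup>2\<close>, \<open>u\<close> and \<open>1\<close> in
  \<open>u v (|a u + b v + c|\<^sup>2 - d\<^sup>2)\<close> after replacing the conjugates of the
  unit numbers \<open>u\<close>, \<open>v\<close> by their inverses.\<close>

definition lead :: "complex poly" where
  "lead = [:a * b, a * c:]"

definition middle :: "complex poly" where
  "middle = [:b * c, b\<^sup>2 + c\<^sup>2 + a\<^sup>2 - d\<^sup>2, b * c:]"

definition last_coeff :: "complex poly" where
  "last_coeff = [:0, a * c, a * b:]"

lemma linkage_quadratic:
  assumes "(u, v) \<in> linkage"
  shows "poly lead v * u\<^sup>2 + poly middle v * u + poly last_coeff v = 0"
proof -
  have 1: "u * cnj u = 1" "v * cnj v = 1" and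
    n: "norm (a * u + b * v + c) = d"
    using assms by (auto simp: linkage_def complex_norm_square[symmetric])
  have "(a * u + b * v + c) * cnj (a * u + b * v + c) = d\<^sup>2"
    using n by (metis complex_norm_square of_real_power)
  then have "(a * u + b * v + c) * (a * cnj u + b * cnj v + c) = d\<^sup>2"
    by simp
  then have "u * v * ((a * u + b * v + c) * (a * cnj u + b * cnj v + c) - d\<^sup>2) = 0"
    by simp
  moreover have "u * v * ((a * u + b * v + c) * (a * cnj u + b * cnj v + c) - d\<^sup>2) =
    (a * u + b * v + c) * (a * v * (u * cnj u) + b * u * (v * cnj v) + c * u * v) - d\<^sup>2 * u * v"
    by (simp add: algebra_simps)
  ultimately show ?thesis
    unfolding 1 by (simp add: lead_def middle_def last_coeff_def algebra_simps power2_eq_square)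
qed

text \<open>Put \<open>m = (b + c v)(b v + c)\<close>. Then \<open>middle\<close> is
  \<open>m + (a\<^sup>2 - d\<^sup>2) v\<close> and \<open>lead * last_coeff\<close> is
  \<open>a\<^sup>2 v m\<close>, which gives the factors \<open>m - (a + d)\<^sup>2 v\<close> and
  \<open>m - (a - d)\<^sup>2 v\<close>. For \<open>|v| = 1\<close>, \<open>m / v\<close> is
  \<open>|b v + c|\<^sup>2\<close>: the factors vanish where the triangle with sides
  \<open>a\<close>, \<open>d\<close>, \<open>|b v + c|\<close> degenerates.\<close>

lemma discriminant:
  "middle * middle - smult 4 (lead * last_coeff) =
    [:complex_of_real (b * c), b\<^sup>2 + c\<^sup>2 - (a + d)\<^sup>2, b * c:] *
    [:complex_of_real (b * c), b\<^sup>2 + c\<^sup>2 - (a - d)\<^sup>2, b * c:]"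
proof -
  have "[:b * c, b\<^sup>2 + c\<^sup>2 + a\<^sup>2 - d\<^sup>2, b * c:] * [:b * c, b\<^sup>2 + c\<^sup>2 + a\<^sup>2 - d\<^sup>2, b * c:] -
      smult 4 ([:a * b, a * c:] * [:0, a * c, a * b:]) =
    [:b * c, b\<^sup>2 + c\<^sup>2 - (a + d)\<^sup>2, b * c:] * [:b * c, b\<^sup>2 + c\<^sup>2 - (a - d)\<^sup>2, b * c:]"
    for a b c d :: complex
    by (simp add: power2_eq_square) algebra
  from this[of b c a d] show ?thesis
    by (simp only: middle_def lead_def last_coeff_def of_real_mult of_real_add of_real_diff of_real_power)
qed

end

locale non_kite = quadrilateral +
  assumes non_kite: "\<not> (a = b \<and> c = d)" "\<not> (a = c \<and> b = d)" "\<not> (a = d \<and> b = c)"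
begin

text \<open>If the discriminant is a square in the field of rational functions, both middle
  coefficients are \<open>2 b c\<close> up to sign. As \<open>\<alpha> < \<beta>\<close>, they are
  \<open>- 2 b c\<close> and \<open>2 b c\<close>, which says \<open>b + c = a + d\<close> and
  \<open>|b - c| = |a - d|\<close>: two of the excluded pairings.\<close>

lemma discriminant_not_square:
  assumes "R * R = (middle * middle - smult 4 (lead * last_coeff)) * (P * P)"
  shows "P = 0"
proof (rule ccontr)
  assume "P \<noteq> 0"
  define \<alpha> where "\<alpha> = b\<^sup>2 + c\<^sup>2 - (a + d)\<^sup>2"
  define \<beta> where "\<beta> = b\<^sup>2 + c\<^sup>2 - (a - d)\<^sup>2"
  have lt: "\<alpha> < \<beta>"
    using pos by (simp add: \<alpha>_def \<beta>_def power2_eq_square algebra_simps)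
  have eq: "R * R = ([:complex_of_real (b * c), \<alpha>, b * c:] * [:complex_of_real (b * c), \<beta>, b * c:]) * (P * P)"
    using assms unfolding discriminant by (simp add: \<alpha>_def \<beta>_def)
  then have eq': "R * R = ([:complex_of_real (b * c), \<beta>, b * c:] * [:complex_of_real (b * c), \<alpha>, b * c:]) * (P * P)"
    by (simp only: mult.commute)
  have k: "complex_of_real (b * c) \<noteq> 0" "complex_of_real \<alpha> \<noteq> complex_of_real \<beta>"
    using pos lt by (auto simp del: of_real_mult)
  have "complex_of_real (\<alpha>\<^sup>2) = complex_of_real (4 * (b * c)\<^sup>2)"
    using palindromic_quadratics_square[OF k \<open>P \<noteq> 0\<close> eq] by simp
  then have "\<alpha>\<^sup>2 = (2 * (b * c))\<^sup>2"
    unfolding of_real_eq_iff by (simp add: power_mult_distrib)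
  moreover have "complex_of_real (\<beta>\<^sup>2) = complex_of_real (4 * (b * c)\<^sup>2)"
    using palindromic_quadratics_square[OF k(1) k(2)[symmetric] \<open>P \<noteq> 0\<close> eq'] by simp
  then have "\<beta>\<^sup>2 = (2 * (b * c))\<^sup>2"
    unfolding of_real_eq_iff by (simp add: power_mult_distrib)
  ultimately have "\<alpha> = 2 * (b * c) \<or> \<alpha> = - (2 * (b * c))" "\<beta> = 2 * (b * c) \<or> \<beta> = - (2 * (b * c))"
    unfolding power2_eq_iff by auto
  moreover have "b * c > 0"
    using pos by simp
  ultimately have "\<alpha> = - (2 * (b * c))" "\<beta> = 2 * (b * c)"
    using lt by linarith+
  then have "(b + c)\<^sup>2 = (a + d)\<^sup>2" and diff: "(b - c)\<^sup>2 = (a - d)\<^sup>2"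
    by (simp_all add: \<alpha>_def \<beta>_def power2_eq_square algebra_simps)
  then have "b + c = a + d"
    using pos by (simp add: power2_eq_iff)
  moreover have "b - c = a - d \<or> b - c = d - a"
    using diff by (auto simp: power2_eq_iff)
  ultimately show False
    using non_kite by auto
qed

text \<open>Up to nonzero factors the two values are \<open>b v + c\<close> and its conjugate. Their
  vanishing forces \<open>b = c\<close> and then \<open>a = d\<close>, the third excluded pairing,
  for which the linkage contains the whole circle \<open>v = -1\<close>.\<close>

lemma linkage_coeffs_neq_0:
  assumes "(u, v) \<in> linkage"
  shows "poly lead v \<noteq> 0" "poly last_coeff v \<noteq> 0"
proof -
  have n: "norm u = 1" "norm v = 1" "norm (a * u + b * v + c) = d"
    using assms by (auto simp: linkage_def)
  have w: "b * v + c \<noteq> 0"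
  proof
    assume w: "b * v + c = 0"
    then have "norm (b * v) = norm (complex_of_real c)"
      by (metis add_eq_0_iff2 norm_minus_cancel)
    then have "b = c"
      using pos n by (simp add: norm_mult)
    moreover have "norm (a * u) = d"
      using n(3) w by (simp add: add.assoc)
    then have "a = d"
      using pos n by (simp add: norm_mult)
    ultimately show False
      using non_kite by simp
  qed
  have "v \<noteq> 0" and v: "v * cnj v = 1"
    using n by (auto simp: complex_norm_square[symmetric])
  have "poly last_coeff v = a * v * (b * v + c)"
    by (simp add: last_coeff_def algebra_simps)
  then show "poly last_coeff v \<noteq> 0"
    using w pos \<open>v \<noteq> 0\<close> by simp
  have "v * cnj (b * v + c) = b * (v * cnj v) + c * v"
    by (simp add: algebra_simps)
  also have "\<dots> = b + c * v"
    by (simp add: v)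
  finally have "b + c * v \<noteq> 0"
    using w \<open>v \<noteq> 0\<close> by (metis complex_cnj_zero_iff mult_eq_0_iff)
  moreover have "poly lead v = a * (b + c * v)"
    by (simp add: lead_def algebra_simps)
  ultimately show "poly lead v \<noteq> 0"
    using pos by simp
qed

text \<open>The elements of the quadratic extension \<open>\<complex>(v)[u]\<close> without poles on the linkage.\<close>

definition reduced :: "(complex \<times> complex \<Rightarrow> complex) \<Rightarrow> bool" where
  "reduced g \<longleftrightarrow> (\<exists>T P Q. \<forall>u v. (u, v) \<in> linkage \<longrightarrow>
     poly T v \<noteq> 0 \<and> poly T v * g (u, v) = poly P v * u + poly Q v)"

lemma reducedI:
  assumes "\<And>u v. (u, v) \<in> linkage \<Longrightarrow>
     poly T v \<noteq> 0 \<and> poly T v * g (u, v) = poly P v * u + poly Q v"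
  shows "reduced g"
  using assms unfolding reduced_def by blast

lemma reduced_const: "reduced (\<lambda>_. k)"
  by (rule reducedI[of 1 _ 0 "[:k:]"]) simp

lemma reduced_fst: "reduced fst"
  by (rule reducedI[of 1 _ 1 0]) simp

lemma reduced_snd: "reduced snd"
  by (rule reducedI[of 1 _ 0 "[:0, 1:]"]) simp

lemma reduced_cnj_snd: "reduced (\<lambda>x. cnj (snd x))"
proof (rule reducedI[of "[:0, 1:]" _ 0 1])
  fix u v assume "(u, v) \<in> linkage"
  then have "v * cnj v = 1"
    by (auto simp: linkage_def complex_norm_square[symmetric])
  then show "poly [:0, 1:] v \<noteq> 0 \<and> poly [:0, 1:] v * cnj (snd (u, v)) = poly 0 v * u + poly 1 v"
    by auto
qed

text \<open>The conjugate of \<open>u\<close> is its inverse, and dividing the quadratic relation by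
  \<open>u\<close> expresses it with denominator \<open>last_coeff\<close>.\<close>

lemma reduced_cnj_fst: "reduced (\<lambda>x. cnj (fst x))"
proof (rule reducedI[of last_coeff _ "-lead" "-middle"])
  fix u v assume uv: "(u, v) \<in> linkage"
  then have 1: "u * cnj u = 1"
    by (auto simp: linkage_def complex_norm_square[symmetric])
  have "poly last_coeff v * cnj u = - (poly lead v * u * (u * cnj u) + poly middle v * (u * cnj u))"
    using arg_cong[OF linkage_quadratic[OF uv], of "\<lambda>x. x * cnj u"]
    by (simp add: algebra_simps power2_eq_square eq_neg_iff_add_eq_0)
  then show "poly last_coeff v \<noteq> 0 \<and> poly last_coeff v * cnj (fst (u, v)) = poly (- lead) v * u + poly (- middle) v"
    using linkage_coeffs_neq_0[OF uv] by (simp add: 1)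
qed

lemma reduced_add:
  assumes "reduced f" "reduced g"
  shows "reduced (\<lambda>x. f x + g x)"
proof -
  obtain T P Q T' P' Q' where
    f: "\<And>u v. (u, v) \<in> linkage \<Longrightarrow> poly T v \<noteq> 0 \<and> poly T v * f (u, v) = poly P v * u + poly Q v" and
    g: "\<And>u v. (u, v) \<in> linkage \<Longrightarrow> poly T' v \<noteq> 0 \<and> poly T' v * g (u, v) = poly P' v * u + poly Q' v"
    using assms unfolding reduced_def by metis
  show ?thesis
  proof (rule reducedI[of "T * T'" _ "T' * P + T * P'" "T' * Q + T * Q'"])
    fix u v assume uv: "(u, v) \<in> linkage"
    have "poly (T * T') v * (f (u, v) + g (u, v)) =
      poly T' v * (poly T v * f (u, v)) + poly T v * (poly T' v * g (u, v))"
      by (simp add: algebra_simps)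
    also have "\<dots> = poly (T' * P + T * P') v * u + poly (T' * Q + T * Q') v"
      unfolding f[OF uv, THEN conjunct2] g[OF uv, THEN conjunct2] by (simp add: algebra_simps)
    finally show "poly (T * T') v \<noteq> 0 \<and> poly (T * T') v * (f (u, v) + g (u, v)) =
      poly (T' * P + T * P') v * u + poly (T' * Q + T * Q') v"
      using f[OF uv] g[OF uv] by simp
  qed
qed

lemma reduced_mult:
  assumes "reduced f" "reduced g"
  shows "reduced (\<lambda>x. f x * g x)"
proof -
  obtain T P Q T' P' Q' where
    f: "\<And>u v. (u, v) \<in> linkage \<Longrightarrow> poly T v \<noteq> 0 \<and> poly T v * f (u, v) = poly P v * u + poly Q v" and
    g: "\<And>u v. (u, v) \<in> linkage \<Longrightarrow> poly T' v \<noteq> 0 \<and> poly T' v * g (u, v) = poly P' v * u + poly Q' v"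
    using assms unfolding reduced_def by metis
  \<comment> \<open>The term in \<open>u\<^sup>2\<close> of the product is eliminated by the
    quadratic relation, at the price of one more factor \<open>lead\<close> in the
    denominator.\<close>
  let ?P = "lead * (P * Q' + Q * P') - middle * P * P'"
  let ?Q = "lead * Q * Q' - last_coeff * P * P'"
  show ?thesis
  proof (rule reducedI[of "lead * T * T'" _ ?P ?Q])
    fix u v assume uv: "(u, v) \<in> linkage"
    have "poly (lead * T * T') v * (f (u, v) * g (u, v)) =
      poly lead v * ((poly T v * f (u, v)) * (poly T' v * g (u, v)))"
      by (simp add: algebra_simps)
    also have "\<dots> = poly lead v * ((poly P v * u + poly Q v) * (poly P' v * u + poly Q' v))"
      unfolding f[OF uv, THEN conjunct2] g[OF uv, THEN conjunct2] ..
    also have "\<dots> = poly ?P v * u + poly ?Q v +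
      poly P v * poly P' v * (poly lead v * u\<^sup>2 + poly middle v * u + poly last_coeff v)"
      by (simp add: algebra_simps power2_eq_square)
    also have "\<dots> = poly ?P v * u + poly ?Q v"
      by (simp only: linkage_quadratic[OF uv]) simp
    finally show "poly (lead * T * T') v \<noteq> 0 \<and> poly (lead * T * T') v * (f (u, v) * g (u, v)) =
      poly ?P v * u + poly ?Q v"
      using f[OF uv] g[OF uv] linkage_coeffs_neq_0[OF uv] by simp
  qed
qed

lemma reduced_real_polynomial:
  assumes "real_polynomial_function \<phi>"
  shows "reduced (\<lambda>x. complex_of_real (\<phi> x))"
  using assms
proof induction
  case (linear \<phi>)
  interpret bounded_linear \<phi> by fact
  \<comment> \<open>A real-linear functional in \<open>u\<close>, \<open>v\<close> is a complex
    combination of \<open>u\<close>, \<open>v\<close> and their conjugates.\<close>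
  have re: "complex_of_real (Re z) = (1/2) * (z + cnj z)"
    and im: "complex_of_real (Im z) = (1/(2*\<i>)) * (z + (-1) * cnj z)" for z
    by (auto simp: complex_eq_iff)
  have "complex_of_real (\<phi> x) =
    \<phi> (1, 0) * ((1/2) * (fst x + cnj (fst x))) + \<phi> (\<i>, 0) * ((1/(2*\<i>)) * (fst x + (-1) * cnj (fst x))) +
    (\<phi> (0, 1) * ((1/2) * (snd x + cnj (snd x))) + \<phi> (0, \<i>) * ((1/(2*\<i>)) * (snd x + (-1) * cnj (snd x))))" for x
  proof -
    have "x = Re (fst x) *\<^sub>R (1, 0) + Im (fst x) *\<^sub>R (\<i>, 0) + (Re (snd x) *\<^sub>R (0, 1) + Im (snd x) *\<^sub>R (0, \<i>))"
      by (auto simp: prod_eq_iff complex_eq_iff)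
    then have "\<phi> x = Re (fst x) * \<phi> (1, 0) + Im (fst x) * \<phi> (\<i>, 0) + (Re (snd x) * \<phi> (0, 1) + Im (snd x) * \<phi> (0, \<i>))"
      by (metis add scaleR real_scaleR_def)
    then show ?thesis
      unfolding re[symmetric] im[symmetric] by simp
  qed
  then have eq: "(\<lambda>x. complex_of_real (\<phi> x)) = (\<lambda>x.
    \<phi> (1, 0) * ((1/2) * (fst x + cnj (fst x))) + \<phi> (\<i>, 0) * ((1/(2*\<i>)) * (fst x + (-1) * cnj (fst x))) +
    (\<phi> (0, 1) * ((1/2) * (snd x + cnj (snd x))) + \<phi> (0, \<i>) * ((1/(2*\<i>)) * (snd x + (-1) * cnj (snd x)))))"
    by (rule ext)
  show ?case
    unfolding eq
    by (intro reduced_add reduced_mult reduced_const reduced_fst reduced_snd reduced_cnj_fst reduced_cnj_snd)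
next
  case (const k)
  show ?case by (rule reduced_const)
next
  case (add f g)
  then show ?case using reduced_add[OF add.IH] by (simp only: of_real_add)
next
  case (mult f g)
  then show ?case using reduced_mult[OF mult.IH] by (simp only: of_real_mult)
qed

text \<open>The zeros lie over those of the norm of \<open>P u + Q\<close> from \<open>\<complex>(v)[u]\<close> to \<open>\<complex>(v)\<close>, and the norm
  of a nonzero element does not vanish because the discriminant is not a square.\<close>

lemma linkage_zeros:
  assumes "real_polynomial_function \<phi>" "x0 \<in> linkage" "\<phi> x0 \<noteq> 0"
  shows "finite {x \<in> linkage. \<phi> x = 0}"
proof -
  obtain T P Q where
    f: "\<And>u v. (u, v) \<in> linkage \<Longrightarrow> poly T v \<noteq> 0 \<and> poly T v * \<phi> (u, v) = poly P v * u + poly Q v"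
    using reduced_real_polynomial[OF assms(1)] unfolding reduced_def by metis
  \<comment> \<open>\<open>lead\<close> times the norm, that is, the product of
    \<open>P u + Q\<close> over both roots \<open>u\<close> of the quadratic.\<close>
  define N where "N = lead * Q * Q - middle * P * Q + last_coeff * P * P"
  have "lead \<noteq> 0"
    using assms(2) linkage_coeffs_neq_0 by (cases x0) fastforce
  have "N \<noteq> 0"
  proof
    assume "N = 0"
    \<comment> \<open>Completing the square: \<open>N = 0\<close> would exhibit the discriminant
      times \<open>P * P\<close> as a square.\<close>
    have "(2 * lead * Q - middle * P) * (2 * lead * Q - middle * P) =
      4 * lead * N + (middle * middle - smult 4 (lead * last_coeff)) * (P * P)"
      by (simp add: N_def algebra_simps numeral_poly)
    then have "P = 0"
      using discriminant_not_square \<open>N = 0\<close> by simp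
    then have "Q = 0"
      using \<open>N = 0\<close> \<open>lead \<noteq> 0\<close> by (simp add: N_def)
    with \<open>P = 0\<close> f assms(2,3) show False
      by (cases x0) fastforce
  qed
  \<comment> \<open>Finitely many \<open>v\<close>, each with at most two \<open>u\<close>. Where
    \<open>lead\<close> vanishes the quadratic could degenerate to zero, but no linkage point lies
    there, so the fibre is set to be empty.\<close>
  have "{x \<in> linkage. \<phi> x = 0} \<subseteq>
    (\<Union>v \<in> {v. poly N v = 0}. if poly lead v = 0 then {} else {u. poly [:poly last_coeff v, poly middle v, poly lead v:] u = 0} \<times> {v})"
  proof safe
    fix u v assume uv: "(u, v) \<in> linkage" and "\<phi> (u, v) = 0"
    then have 0: "poly P v * u + poly Q v = 0"
      using f[OF uv] by simp
    then have Q: "poly Q v = - (poly P v * u)"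
      by (simp add: eq_neg_iff_add_eq_0 add.commute)
    have "poly N v = (poly P v)\<^sup>2 * (poly lead v * u\<^sup>2 + poly middle v * u + poly last_coeff v)"
      by (simp add: N_def Q algebra_simps power2_eq_square)
    then have "poly N v = 0"
      by (simp add: linkage_quadratic[OF uv])
    moreover have "poly [:poly last_coeff v, poly middle v, poly lead v:] u = 0"
      using linkage_quadratic[OF uv] by (simp add: algebra_simps power2_eq_square)
    ultimately show "(u, v) \<in> (\<Union>v \<in> {v. poly N v = 0}. if poly lead v = 0 then {} else {u. poly [:poly last_coeff v, poly middle v, poly lead v:] u = 0} \<times> {v})"
      using linkage_coeffs_neq_0[OF uv] by auto
  qed
  moreover have "finite \<dots>"
  proof (rule finite_UN_I)
    show "finite {v. poly N v = 0}"
      using \<open>N \<noteq> 0\<close> by (rule poly_roots_finite)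
    fix v
    show "finite (if poly lead v = 0 then {} else {u. poly [:poly last_coeff v, poly middle v, poly lead v:] u = 0} \<times> {v})"
      using poly_roots_finite[of "[:poly last_coeff v, poly middle v, poly lead v:]"] by auto
  qed
  ultimately show ?thesis
    by (rule finite_subset)
qed

end

section \<open>Existence of infinitely many configurations\<close>

lemma unit_with_norm:
  fixes a b t :: real
  assumes "a > 0" "b > 0" "\<bar>a - b\<bar> \<le> t" "t \<le> a + b"
  obtains u :: complex where "norm u = 1" "norm (a * u + b) = t"
proof
  \<comment> \<open>Law of cosines:
    \<open>|a u + b|\<^sup>2 = a\<^sup>2 + b\<^sup>2 + 2 a b Re u\<close>, solved for
    \<open>x = Re u\<close>.\<close>
  define x where "x = (t\<^sup>2 - a\<^sup>2 - b\<^sup>2) / (2 * a * b)"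
  have t: "(a - b)\<^sup>2 \<le> t\<^sup>2" "t\<^sup>2 \<le> (a + b)\<^sup>2"
    using assms by (auto simp: abs_le_square_iff[symmetric])
  have x: "2 * a * b * x = t\<^sup>2 - a\<^sup>2 - b\<^sup>2"
    using assms by (simp add: x_def)
  have "x \<le> 1" "-1 \<le> x"
    using assms t by (auto simp: x_def field_simps power2_eq_square)
  then have x2: "x\<^sup>2 \<le> 1"
    by (simp add: abs_square_le_1 abs_le_iff)
  let ?u = "Complex x (sqrt (1 - x\<^sup>2))"
  show "norm ?u = 1"
    using x2 by (simp add: complex_norm)
  have "(a * x + b)\<^sup>2 + (a * sqrt (1 - x\<^sup>2))\<^sup>2 = t\<^sup>2"
    using x2 x by (simp add: power_mult_distrib power2_sum algebra_simps)
  then show "norm (a * ?u + b) = t"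
    using assms by (simp add: cmod_def)
qed

context quadrilateral
begin

text \<open>The diagonal \<open>t = |b v + c|\<close> must close the triangles with sides
  \<open>b, c, t\<close> and \<open>a, d, t\<close>, which confines it to an overlap of two
  intervals. The given configuration makes the overlap nonempty, the four inequalities keep it from
  being a single point, and every interior \<open>t\<close> is realised.\<close>

lemma infinite_linkage:
  assumes "(u0, v0) \<in> linkage"
    and "a \<noteq> b + c + d" "b \<noteq> a + c + d" "c \<noteq> a + b + d" "d \<noteq> a + b + c"
  shows "infinite linkage"
proof
  assume fin: "finite linkage"
  define lo where "lo = max \<bar>b - c\<bar> \<bar>a - d\<bar>"
  define hi where "hi = min (b + c) (a + d)"
  have n0: "norm u0 = 1" "norm v0 = 1" "norm (a * u0 + b * v0 + c) = d"
    using assms(1) by (auto simp: linkage_def)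
  have n1: "norm (a * u0) = a" "norm (b * v0) = b" "norm (complex_of_real c) = c"
    using n0 pos by (auto simp: norm_mult)
  have "\<bar>a - d\<bar> \<le> norm (b * v0 + c)" "norm (b * v0 + c) \<le> a + d"
    using norm_triangle_ineq4[of "a * u0 + b * v0 + c" "a * u0"]
      norm_triangle_ineq3[of "a * u0 + b * v0 + c" "a * u0"] 
      n0 n1 by (simp_all add: add.assoc abs_minus_commute)
  moreover have "\<bar>b - c\<bar> \<le> norm (b * v0 + c)" "norm (b * v0 + c) \<le> b + c"
    using norm_triangle_ineq[of "b * v0" c] norm_triangle_ineq3[of "b * v0" "- complex_of_real c"] n1 
    by simp_all
  ultimately have "lo < hi"
    using assms(2-) pos by (auto simp: lo_def hi_def)
  have "{lo<..<hi} \<subseteq> (\<lambda>(u, v). norm (b * v + c)) ` linkage"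
  proof
    fix t assume "t \<in> {lo<..<hi}"
    then have t: "\<bar>b - c\<bar> \<le> t" "t \<le> b + c" "\<bar>a - d\<bar> < t" "t < a + d"
      by (auto simp: lo_def hi_def)
    obtain v :: complex where v: "norm v = 1" "norm (b * v + c) = t"
      by (rule unit_with_norm[OF pos(2,3) t(1,2)])
    have "t > 0" "\<bar>a - t\<bar> \<le> d" "d \<le> a + t"
      using t by linarith+
    then obtain u :: complex where u: "norm u = 1" "norm (a * u + t) = d"
      by (rule unit_with_norm[OF pos(1)])
    \<comment> \<open>\<open>u\<close> was found for a diagonal along the positive real axis;
      \<open>\<omega>\<close> is the actual direction, so \<open>u\<close> is rotated by it.\<close>
    define \<omega> where "\<omega> = (b * v + c) / t"
    have "norm \<omega> = 1"
      using v \<open>t > 0\<close> by (simp add: \<omega>_def norm_divide)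
    have "a * (u * \<omega>) + b * v + c = (a * u + t) * \<omega>"
      using \<open>t > 0\<close> by (simp add: \<omega>_def algebra_simps add_divide_distrib)
    then have "(u * \<omega>, v) \<in> linkage"
      using u v \<open>norm \<omega> = 1\<close> by (simp add: linkage_def norm_mult)
    then show "t \<in> (\<lambda>(u, v). norm (b * v + c)) ` linkage"
      using v(2) by (force simp: image_iff)
  qed
  then show False
    using fin \<open>lo < hi\<close> infinite_Ioo finite_subset by blast
qed

end

section \<open>Real algebraic sets in the projective plane\<close>

lemma scaleR_eq_smult: "r *\<^sub>R x = complex_of_real r *s x" for x :: V
  by (simp add: vec_eq_iff scaleR_conv_of_real[where 'a = complex])

lemma linear_smult: "linear (\<lambda>x :: V. k *s x)"
  by (rule linearI) (simp_all add: vec.scale_right_distrib scaleR_eq_smult mult.commute)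

lemma polynomial_function_smult: "polynomial_function (\<lambda>x :: V. k *s x)"
  using linear_smult by (simp add: linear_conv_bounded_linear polynomial_function_bounded_linear)

lemma proj_planeE:
  assumes "L \<in> proj_plane"
  obtains v where "v \<noteq> 0" "L = range (\<lambda>k. k *s v)"
  using assms unfolding proj_plane_def by (auto simp: vec.span_singleton)

lemma smult_mem_proj_plane:
  assumes "L \<in> proj_plane" "p \<in> L"
  shows "k *s p \<in> L"
  using assms unfolding proj_plane_def by (auto intro: vec.span_scale)

lemma subspace_proj_plane: "L \<in> proj_plane \<Longrightarrow> subspace L"
  unfolding proj_plane_def subspace_def
  by (auto intro: vec.span_zero vec.span_add vec.span_scale simp: scaleR_eq_smult)

lemma proj_plane_subset_eq:
  assumes "L \<in> proj_plane" "L' \<in> proj_plane" "L \<subseteq> L'"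
  shows "L = L'"
proof -
  obtain v w where v: "v \<noteq> 0" "L = vec.span {v}" and w: "L' = vec.span {w}"
    using assms by (auto simp: proj_plane_def)
  have "v \<in> L'"
    using assms v vec.span_base by blast
  then obtain k where k: "v = k *s w"
    using w by (auto simp: vec.span_singleton)
  then have "w = inverse k *s v"
    using v by auto
  then have "w \<in> L"
    using v vec.span_base[of v "{v}"] vec.span_scale by auto
  then have "L' \<subseteq> L"
    using v w by (metis empty_subsetI insert_subset vec.span_minimal vec.subspace_span)
  then show ?thesis
    using assms by auto
qed

lemma real_algebraicI:
  assumes "\<And>f. f \<in> F \<Longrightarrow> real_polynomial_function f"
    and "\<And>L. L \<in> S \<longleftrightarrow> L \<in> proj_plane \<and> (\<forall>p\<in>L. \<forall>f\<in>F. f p = 0)"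
  shows "real_algebraic S"
  unfolding real_algebraic_def
proof (intro exI conjI)
  show "\<forall>f\<in>F. real_polynomial_function f"
    using assms(1) by (rule ballI)
  show "S = {L \<in> proj_plane. \<forall>p\<in>L. \<forall>f\<in>F. f p = 0}"
    using assms(2) by (intro set_eqI) (simp only: mem_Collect_eq)
qed

lemma real_algebraicE:
  assumes "real_algebraic S"
  obtains F where "\<forall>f\<in>F. real_polynomial_function f"
    and "\<forall>L. L \<in> S \<longleftrightarrow> L \<in> proj_plane \<and> (\<forall>p\<in>L. \<forall>f\<in>F. f p = 0)"
proof -
  obtain F where F: "\<forall>f\<in>F. real_polynomial_function f"
      "S = {L \<in> proj_plane. \<forall>p\<in>L. \<forall>f\<in>F. f p = 0}"
    using assms unfolding real_algebraic_def by (elim exE conjE)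
  show ?thesis
    using F(1) by (rule that) (simp add: F(2))
qed

lemma real_algebraic_subset_proj_plane: "real_algebraic S \<Longrightarrow> S \<subseteq> proj_plane"
  by (auto elim: real_algebraicE)

lemma real_algebraic_empty: "real_algebraic {}"
  by (rule real_algebraicI[of "{\<lambda>_. 1}"])
    (auto intro: real_polynomial_function.intros(2) elim: proj_planeE)

text \<open>\<open>L\<close> is a real subspace, hence cut out by real-linear functionals. The one
  used for \<open>p\<close> is the inner product with the component \<open>z\<close> of
  \<open>p\<close> orthogonal to \<open>L\<close>; its vanishing at \<open>p\<close> gives
  \<open>z = 0\<close>.\<close>

lemma real_algebraic_singleton:
  assumes "L \<in> proj_plane"
  shows "real_algebraic {L}"
proof -
  let ?F = "{f. real_polynomial_function f \<and> (\<forall>p\<in>L. f p = 0)}"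
  have "L' = L" if L': "L' \<in> proj_plane" "\<forall>p\<in>L'. \<forall>f\<in>?F. f p = 0" for L'
  proof (rule proj_plane_subset_eq[OF L'(1) assms], rule)
    fix p assume "p \<in> L'"
    have L: "span L = L"
      using subspace_proj_plane[OF assms] by (rule span_eq_iff[THEN iffD2])
    obtain y z where yz: "y \<in> span L" "\<And>w. w \<in> span L \<Longrightarrow> orthogonal z w" "p = y + z"
      using orthogonal_subspace_decomp_exists[of L p] by blast
    have "(\<lambda>x. x \<bullet> z) \<in> ?F"
      using yz(2) L by (auto simp: orthogonal_def inner_commute intro!: real_polynomial_function.intros(1) bounded_linear_inner_left)
    then have "p \<bullet> z = 0"
      using bspec[OF bspec[OF L'(2) \<open>p \<in> L'\<close>]] by simp
    then have "z = 0"
      using yz(2)[OF yz(1)] by (simp add: yz(3) inner_add_left orthogonal_def inner_commute[of z y])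
    then show "p \<in> L"
      using yz L by simp
  qed
  then show ?thesis
    using assms by (intro real_algebraicI[of ?F]) auto
qed

text \<open>The pointwise products \<open>f g\<close> do not suffice: \<open>f\<close> and \<open>g\<close> may fail to vanish at different
  points of the same line. Hence the rescalings.\<close>

lemma real_algebraic_Un:
  assumes "real_algebraic A" "real_algebraic B"
  shows "real_algebraic (A \<union> B)"
proof -
  obtain F where F: "\<forall>f\<in>F. real_polynomial_function f"
    "\<forall>L. L \<in> A \<longleftrightarrow> L \<in> proj_plane \<and> (\<forall>p\<in>L. \<forall>f\<in>F. f p = 0)"
    using assms(1) by (rule real_algebraicE)
  obtain G where G: "\<forall>g\<in>G. real_polynomial_function g"
    "\<forall>L. L \<in> B \<longleftrightarrow> L \<in> proj_plane \<and> (\<forall>p\<in>L. \<forall>f\<in>G. f p = 0)"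
    using assms(2) by (rule real_algebraicE)
  define K where "K = {\<lambda>x. f (k *s x) * g (m *s x) | f g k m. f \<in> F \<and> g \<in> G}"
  have "real_polynomial_function h" if "h \<in> K" for h
  proof -
    obtain f g k m where h: "h = (\<lambda>x. f (k *s x) * g (m *s x))" "f \<in> F" "g \<in> G"
      using \<open>h \<in> K\<close> unfolding K_def by blast
    then show ?thesis
      using F(1) G(1) real_polynomial_function_compose[OF polynomial_function_smult]
      by (auto simp: o_def intro!: real_polynomial_function.intros(4))
  qed
  moreover have "L \<in> A \<union> B \<longleftrightarrow> (\<forall>p\<in>L. \<forall>h\<in>K. h p = 0)" if L: "L \<in> proj_plane" for L
  proof
    assume "L \<in> A \<union> B"
    then show "\<forall>p\<in>L. \<forall>h\<in>K. h p = 0"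
      using smult_mem_proj_plane[OF L] by (auto simp: F(2) G(2) K_def)
  next
    assume K: "\<forall>p\<in>L. \<forall>h\<in>K. h p = 0"
    obtain v where v: "L = range (\<lambda>k. k *s v)"
      using L by (rule proj_planeE)
    have "v \<in> L"
      unfolding v by (rule range_eqI[of _ _ 1]) simp
    show "L \<in> A \<union> B"
    proof (rule ccontr)
      assume "L \<notin> A \<union> B"
      then obtain f g p q where fg: "f \<in> F" "g \<in> G" "p \<in> L" "q \<in> L" "f p \<noteq> 0" "g q \<noteq> 0"
        using L by (auto simp: F(2) G(2))
      then obtain k m where km: "p = k *s v" "q = m *s v"
        using v by auto
      have h: "(\<lambda>x. f (k *s x) * g (m *s x)) \<in> K"
        unfolding K_def using fg by blast
      have "f (k *s v) * g (m *s v) = 0"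
        by (rule bspec[OF bspec[OF K \<open>v \<in> L\<close>] h])
      then show False
        using fg km by simp
    qed
  qed
  ultimately show ?thesis
    using real_algebraic_subset_proj_plane assms
    by (intro real_algebraicI[of K]) blast+
qed

lemma real_algebraic_finite: "finite A \<Longrightarrow> A \<subseteq> proj_plane \<Longrightarrow> real_algebraic A"
proof (induction rule: finite_induct)
  case (insert L A)
  then show ?case
    using real_algebraic_Un[OF real_algebraic_singleton, of L A] by simp
qed (rule real_algebraic_empty)

section \<open>Irreducible sets and dimension\<close>

lemma irreducible_algebraic_singleton: "L \<in> proj_plane \<Longrightarrow> irreducible_algebraic {L}"
  unfolding irreducible_algebraic_def using real_algebraic_singleton by blast

lemma irreducible_algebraic_finite:
  assumes "finite Z" "irreducible_algebraic Z"
  obtains L where "Z = {L}"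
proof -
  have Z: "Z \<subseteq> proj_plane" "Z \<noteq> {}"
    using assms real_algebraic_subset_proj_plane by (auto simp: irreducible_algebraic_def)
  then obtain L where "L \<in> Z" by blast
  then have "Z = {L} \<union> (Z - {L})" by blast
  moreover have "real_algebraic {L}" "real_algebraic (Z - {L})"
    using Z \<open>L \<in> Z\<close> \<open>finite Z\<close> by (auto intro!: real_algebraic_finite)
  ultimately have "{L} = Z \<or> Z - {L} = Z"
    using assms(2) unfolding irreducible_algebraic_def by blast
  then show ?thesis
    using \<open>L \<in> Z\<close> that by blast
qed

text \<open>By \<open>fin\<close> every proper algebraic subset is finite, so the infinite
  \<open>S\<close> is not a union of two of them. In a chain of length 2 the middle set would be
  finite and irreducible, hence one point, leaving only the empty set below it.\<close>

lemma irreducible_algebraic_curveI: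
  assumes alg: "real_algebraic S" and inf: "infinite S"
    and fin: "\<And>f L p. real_polynomial_function f \<Longrightarrow> L \<in> S \<Longrightarrow> p \<in> L \<Longrightarrow> f p \<noteq> 0 \<Longrightarrow>
      finite {L \<in> S. \<forall>p\<in>L. f p = 0}"
  shows "irreducible_algebraic_curve S"
proof -
  have proper: "finite A" if A: "real_algebraic A" "A \<subseteq> S" "A \<noteq> S" for A
  proof -
    obtain F where F: "\<forall>f\<in>F. real_polynomial_function f"
      "\<forall>L. L \<in> A \<longleftrightarrow> L \<in> proj_plane \<and> (\<forall>p\<in>L. \<forall>f\<in>F. f p = 0)"
      using A(1) by (rule real_algebraicE)
    obtain L where L: "L \<in> S" "L \<notin> A"
      using A by blast
    moreover have "L \<in> proj_plane"
      using alg L real_algebraic_subset_proj_plane by blast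
    ultimately obtain f p where f: "f \<in> F" "p \<in> L" "f p \<noteq> 0"
      by (auto simp: F(2))
    have "A \<subseteq> {L \<in> S. \<forall>p\<in>L. f p = 0}"
      using f(1) A(2) by (auto simp: F(2))
    then show ?thesis
      using fin[OF bspec[OF F(1) f(1)] L(1) f(2,3)] finite_subset by blast
  qed
  have irr: "irreducible_algebraic S"
    unfolding irreducible_algebraic_def
  proof (intro conjI allI impI)
    show "S \<noteq> {}"
      using inf by auto
    fix A B assume "real_algebraic A" "real_algebraic B" "S = A \<union> B"
    then show "A = S \<or> B = S"
      using proper[of A] proper[of B] inf by blast
  qed (rule alg)
  have "algebraic_dim S = 1"
    unfolding algebraic_dim_def
  proof (rule antisym[OF Sup_least Sup_upper])
    fix x :: enat
    assume "x \<in> {enat n | n. \<exists>Z :: nat \<Rightarrow> V set set.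
            (\<forall>i\<le>n. irreducible_algebraic (Z i) \<and> Z i \<subseteq> S) \<and> (\<forall>i<n. Z i \<subset> Z (Suc i))}"
    then obtain n Z where n: "x = enat n" and
      Z: "\<And>i. i \<le> n \<Longrightarrow> irreducible_algebraic (Z i)" "\<And>i. i \<le> n \<Longrightarrow> Z i \<subseteq> S"
        "\<And>i. i < n \<Longrightarrow> Z i \<subset> Z (Suc i)"
      by blast
    have "n \<le> 1"
    proof (rule ccontr)
      assume "\<not> n \<le> 1"
      then have Z012: "Z 0 \<subset> Z 1" "Z 1 \<subset> Z 2" "Z 2 \<subseteq> S" "irreducible_algebraic (Z 0)" "irreducible_algebraic (Z 1)"
        using Z(1)[of 0] Z(1)[of 1] Z(2)[of 2] Z(3)[of 0] Z(3)[of 1] by (auto simp: numeral_2_eq_2)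
      then have "finite (Z 1)"
        by (intro proper) (auto simp: irreducible_algebraic_def)
      then obtain L where "Z 1 = {L}"
        using Z012(5) by (rule irreducible_algebraic_finite)
      then show False
        using Z012 by (auto simp: irreducible_algebraic_def)
    qed
    then show "x \<le> 1"
      by (simp add: n one_enat_def)
  next
    obtain L where "L \<in> S"
      using inf by (metis finite.emptyI ex_in_conv)
    moreover have "L \<in> proj_plane"
      using alg \<open>L \<in> S\<close> real_algebraic_subset_proj_plane by blast
    moreover have "{L} \<noteq> S"
      using inf by auto
    \<comment> \<open>The chain from a point to \<open>S\<close> shows that the dimension is at
      least 1.\<close>
    ultimately have "(\<forall>i\<le>1. irreducible_algebraic ((if i = (0::nat) then {L} else S)) \<and> (if i = 0 then {L} else S) \<subseteq> S) \<and>
        (\<forall>i<1. (if i = (0::nat) then {L} else S) \<subset> (if Suc i = 0 then {L} else S))"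
      using irr irreducible_algebraic_singleton by auto
    then have "\<exists>Z :: nat \<Rightarrow> V set set. (\<forall>i\<le>1. irreducible_algebraic (Z i) \<and> Z i \<subseteq> S) \<and> (\<forall>i<1. Z i \<subset> Z (Suc i))"
      by (rule exI[of _ "\<lambda>i. if i = 0 then {L} else S"])
    then show "1 \<in> {enat n | n. \<exists>Z :: nat \<Rightarrow> V set set.
            (\<forall>i\<le>n. irreducible_algebraic (Z i) \<and> Z i \<subseteq> S) \<and> (\<forall>i<n. Z i \<subset> Z (Suc i))}"
      unfolding one_enat_def by blast
  qed
  then show ?thesis
    using irr by (simp add: irreducible_algebraic_curve_def)
qed

section \<open>Hermitian forms of signature \<open>++-\<close>\<close>

lemma Re_mult_cnj_mult: "Re (z * cnj z * w) = (norm z)\<^sup>2 * Re w"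
  by (simp add: cmod_power2) (simp add: power2_eq_square algebra_simps)

lemma Re_mult_cnj: "Re (z * cnj z) = (norm z)\<^sup>2"
  using Re_mult_cnj_mult[of z 1] by simp

section \<open>Triples of vectors in general position\<close>

lemma columns_mult:
  fixes x y z :: V
  defines "A \<equiv> (\<chi> i j. (if j = 1 then x else if j = 2 then y else z) $ i) :: endo"
  shows "A *v v = v $ 1 *s x + v $ 2 *s y + v $ 3 *s z"
  by (simp add: A_def vec_eq_iff matrix_vector_mult_def sum_3 mult.commute)

lemma independent_triple_spans:
  fixes x y z w :: V
  assumes "\<And>r s t. r *s x + s *s y + t *s z = 0 \<Longrightarrow> r = 0 \<and> s = 0 \<and> t = 0"
  obtains r s t where "w = r *s x + s *s y + t *s z"
proof -
  let ?A = "(\<chi> i j. (if j = 1 then x else if j = 2 then y else z) $ i) :: endo"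
  have "\<forall>v. ?A *v v = 0 \<longrightarrow> v = 0"
  proof (intro allI impI)
    fix v assume "?A *v v = 0"
    then have "v $ 1 = 0 \<and> v $ 2 = 0 \<and> v $ 3 = 0"
      unfolding columns_mult by (rule assms)
    then show "v = 0"
      by (simp add: vec_eq_iff forall_3)
  qed
  then have "\<exists>B. B ** ?A = mat 1"
    by (simp add: matrix_left_invertible_ker)
  then have "\<exists>B. ?A ** B = mat 1"
    by (simp add: matrix_left_right_inverse)
  then have "surj ((*v) ?A)"
    by (simp add: matrix_right_invertible_surjective)
  then obtain v where "w = ?A *v v"
    by (auto simp: surj_def)
  then show ?thesis
    using that by (auto simp: columns_mult)
qed

text \<open>\<open>x\<close> and \<open>y\<close> may be dependent, so their span can be too small,
  while general position speaks of subspaces of dimension exactly 2. A two-element set between a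
  basis \<open>B\<close> of the span and an extension to a basis of \<open>V\<close> spans a
  suitable plane.\<close>

lemma pair_in_plane:
  fixes x y :: V
  obtains U where "vec.subspace U" "vec.dim U = 2" "{x, y} \<subseteq> U"
proof -
  obtain B where B: "B \<subseteq> {x, y}" "vec.independent B" "{x, y} \<subseteq> vec.span B"
    using vec.maximal_independent_subset[of "{x, y}"] by blast
  have fB: "finite B" and cB: "card B \<le> 2"
    using B(1) card_mono[OF _ B(1)] card_insert_le_m1[of 2 "{y}" x] by (auto intro: finite_subset)
  let ?C = "vec.extend_basis B"
  have C: "B \<subseteq> ?C" "vec.independent ?C" "vec.span ?C = UNIV"
    using B(2) by (auto simp: vec.extend_basis_superset vec.independent_extend_basis vec.span_extend_basis)
  have "card ?C = vec.dim (UNIV :: V set)"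
    using C vec.dim_span_eq_card_independent[of ?C] by simp
  then have cC: "card ?C = 3"
    by (simp add: vec.dim_UNIV card_cart_basis)
  then have fC: "finite ?C"
    by (metis card.infinite zero_neq_numeral)
  obtain D where D: "B \<subseteq> D" "D \<subseteq> ?C" "card D = 2"
    using exists_subset_between[of B 2 ?C] cB cC C(1) fC by auto
  have "vec.independent D"
    using C(2) D(2) vec.independent_mono by blast
  then have "vec.dim (vec.span D) = 2"
    using D(3) by (simp add: vec.dim_eq_card_independent)
  moreover have "{x, y} \<subseteq> vec.span D"
    using B(3) D(1) vec.span_mono by blast
  ultimately show ?thesis
    using that vec.subspace_span by blast
qed

text \<open>A nonzero coefficient would put \<open>x\<close> into every plane through
  \<open>y\<close> and \<open>z\<close>.\<close>

lemma general_triple_coeff: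
  fixes x y z :: V
  assumes "\<nexists>U. vec.subspace U \<and> vec.dim U = 2 \<and> {x, y, z} \<subseteq> U"
    and rel: "r *s x + s *s y + t *s z = 0"
  shows "r = 0"
proof (rule ccontr)
  assume "r \<noteq> 0"
  obtain U where U: "vec.subspace U" "vec.dim U = 2" "{y, z} \<subseteq> U"
    by (rule pair_in_plane)
  have "r *s x = - (s *s y + t *s z)"
    using rel by (simp only: add.assoc add_eq_0_iff2)
  then have "inverse r *s (r *s x) = inverse r *s (- (s *s y + t *s z))"
    by simp
  then have "x = inverse r *s (- (s *s y + t *s z))"
    using \<open>r \<noteq> 0\<close> by simp
  also have "\<dots> \<in> U"
    using U by (intro vec.subspace_scale[OF U(1)] vec.subspace_neg[OF U(1)] vec.subspace_add[OF U(1)]) auto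
  finally show False
    using assms(1) U by auto
qed

lemma general_triple_independent:
  fixes x y z :: V
  assumes "\<nexists>U. vec.subspace U \<and> vec.dim U = 2 \<and> {x, y, z} \<subseteq> U"
    and rel: "r *s x + s *s y + t *s z = 0"
  shows "r = 0 \<and> s = 0 \<and> t = 0"
proof -
  have "s = 0"
    using assms general_triple_coeff[of y x z s r t] by (simp add: insert_commute add.commute)
  moreover have "t = 0"
    using assms general_triple_coeff[of z y x t s r] by (simp add: insert_commute ac_simps)
  ultimately show ?thesis
    using general_triple_coeff[OF assms] by simp
qed

lemma scaleR_matrix_vector: "(r *\<^sub>R A) *v x = complex_of_real r *s (A *v x)" for A :: endo
  by (simp add: vec_eq_iff matrix_vector_mult_def sum_distrib_left scaleR_conv_of_real[where 'a = complex] mult.assoc)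

section \<open>Nondegeneracy, and positivity orthogonal to a negative vector\<close>

locale hermitian_ppm =
  fixes H :: "V \<Rightarrow> V \<Rightarrow> complex"
  assumes hermitian: "hermitian_form H" and signature: "signature_ppm H"
begin

lemma add_left: "H (x + y) z = H x z + H y z"
  and smult_left: "H (k *s x) y = k * H x y"
  and H_sym: "H y x = cnj (H x y)"
  using hermitian unfolding hermitian_form_def by blast+

lemma add_right: "H x (y + z) = H x y + H x z"
  by (simp add: H_sym[of x] add_left)

lemma smult_right: "H x (k *s y) = cnj k * H x y"
  by (simp add: H_sym[of x] smult_left)

lemma zero_left: "H 0 x = 0"
  using smult_left[of 0 0 x] by simp

lemma zero_right: "H x 0 = 0"
  using smult_right[of x 0 0] by simp

lemma diff_left: "H (x - y) z = H x z - H y z"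
  using add_left[of "x - y" y z] by simp

lemma diff_right: "H x (y - z) = H x y - H x z"
  by (simp add: H_sym[of x] diff_left)

lemma sum_left: "H (\<Sum>i\<in>I. f i) y = (\<Sum>i\<in>I. H (f i) y)"
  by (induction I rule: infinite_finite_induct) (auto simp: zero_left add_left)

lemmas form_simps = add_left add_right smult_left smult_right zero_left zero_right diff_left diff_right

lemma orthonormal_basis:
  obtains e1 e2 e3 where "H e1 e1 = 1" "H e2 e2 = 1" "H e3 e3 = -1"
    "H e1 e2 = 0" "H e1 e3 = 0" "H e2 e3 = 0" "H e2 e1 = 0" "H e3 e1 = 0" "H e3 e2 = 0"
    "\<forall>x. x = H x e1 *s e1 + H x e2 *s e2 + (- H x e3) *s e3"
proof -
  obtain e1 e2 e3 where e: "vec.span {e1, e2, e3} = UNIV" and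
    o: "H e1 e1 = 1" "H e2 e2 = 1" "H e3 e3 = -1" "H e1 e2 = 0" "H e1 e3 = 0" "H e2 e3 = 0"
    using signature unfolding signature_ppm_def by blast
  have o': "H e2 e1 = 0" "H e3 e1 = 0" "H e3 e2 = 0"
    using o H_sym[of e1 e2] H_sym[of e1 e3] H_sym[of e2 e3] by simp_all
  have "x = H x e1 *s e1 + H x e2 *s e2 + (- H x e3) *s e3" for x
  proof -
    have "x \<in> vec.span {e1, e2, e3}"
      by (simp add: e)
    then obtain r s t where "x - r *s e1 - s *s e2 - t *s e3 = 0"
      unfolding vec.span_breakdown_eq vec.span_empty by blast
    then have x: "x = r *s e1 + s *s e2 + t *s e3"
      by (simp add: algebra_simps)
    have "H x e1 = r" "H x e2 = s" "H x e3 = - t"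
      unfolding x by (simp_all add: form_simps o o')
    then show ?thesis
      using x by simp
  qed
  then show ?thesis
    by (intro that[OF o o'] allI)
qed

lemma nondegenerate:
  assumes "\<And>y. H x y = 0"
  shows "x = 0"
proof -
  obtain e1 e2 e3 where "\<forall>x. x = H x e1 *s e1 + H x e2 *s e2 + (- H x e3) *s e3"
    by (rule orthonormal_basis)
  from spec[OF this, of x] show ?thesis
    by (simp add: assms)
qed

text \<open>Otherwise \<open>x\<close> and \<open>q\<close> would span a nonpositive plane, which meets the positive plane
  spanned by the first two basis vectors.\<close>

lemma orthogonal_negative_positive:
  assumes q: "Re (H q q) < 0" and xq: "H x q = 0" and "x \<noteq> 0"
  shows "Re (H x x) > 0"
proof (rule ccontr)
  assume nonpos: "\<not> Re (H x x) > 0"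
  obtain e1 e2 e3 where o: "H e1 e1 = 1" "H e2 e2 = 1" "H e3 e3 = -1"
    "H e1 e2 = 0" "H e1 e3 = 0" "H e2 e3 = 0" "H e2 e1 = 0" "H e3 e1 = 0" "H e3 e2 = 0" and
    e: "\<forall>x. x = H x e1 *s e1 + H x e2 *s e2 + (- H x e3) *s e3"
    by (rule orthonormal_basis)
  have norm: "Re (H x x) = (norm (H x e1))\<^sup>2 + (norm (H x e2))\<^sup>2 - (norm (H x e3))\<^sup>2" for x
  proof -
    have "H x x = H x (H x e1 *s e1 + H x e2 *s e2 + (- H x e3) *s e3)"
      using spec[OF e, of x] by (rule arg_cong)
    also have "\<dots> = H x e1 * cnj (H x e1) + H x e2 * cnj (H x e2) - H x e3 * cnj (H x e3)"
      by (simp add: form_simps mult.commute)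
    finally show ?thesis
      by (simp only: plus_complex.sel minus_complex.sel Re_mult_cnj)
  qed
  define s t where "s = H q e3" and "t = H x e3"
  \<comment> \<open>The combination of \<open>x\<close> and \<open>q\<close> without
    \<open>e3\<close>-component, so that it lies in the positive plane.\<close>
  define y where "y = s *s x - t *s q"
  have qx: "H q x = 0"
    using xq H_sym[of q x] by simp
  have "H y e3 = 0"
    by (simp add: y_def form_simps s_def t_def)
  then have "Re (H y y) \<ge> 0"
    using norm[of y] by simp
  moreover have "H y y = (s * cnj s) * H x x + (t * cnj t) * H q q"
    by (simp add: y_def form_simps xq qx algebra_simps)
  then have "Re (H y y) = (norm s)\<^sup>2 * Re (H x x) + (norm t)\<^sup>2 * Re (H q q)"
    by (simp only: plus_complex.sel Re_mult_cnj_mult)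
  moreover have "(norm s)\<^sup>2 * Re (H x x) \<le> 0"
    using nonpos by (simp add: mult_nonneg_nonpos)
  ultimately have "(norm t)\<^sup>2 * Re (H q q) \<ge> 0"
    by linarith
  then have "t = 0"
    using q by (simp add: zero_le_mult_iff)
  then have "(norm (H x e1))\<^sup>2 + (norm (H x e2))\<^sup>2 \<le> 0"
    using norm[of x] nonpos by (simp add: t_def)
  then have "H x e1 = 0" "H x e2 = 0"
    by (simp_all add: sum_power2_le_zero_iff)
  then show False
    using spec[OF e, of x] \<open>t = 0\<close> \<open>x \<noteq> 0\<close> by (simp add: t_def)
qed

lemma rank_one_mult: "rank_one H v w *v x = H x v *s w"
  unfolding rank_one_def
proof (rule matrix_works)
  show "Vector_Spaces.linear (*s) (*s) (\<lambda>x. H x v *s w)"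
    by (auto simp: Vector_Spaces.linear_iff form_simps vec.scale_left_distrib vec.vector_space_axioms)
qed

lemma linear_Re_form: "linear (\<lambda>x. Re (H x y))" and linear_Im_form: "linear (\<lambda>x. Im (H x y))"
proof -
  have "r *\<^sub>R x = complex_of_real r *s x" for r and x :: V
    by (simp add: vec_eq_iff scaleR_conv_of_real[where 'a = complex])
  then show "linear (\<lambda>x. Re (H x y))" "linear (\<lambda>x. Im (H x y))"
    by (auto intro!: linearI simp: form_simps)
qed

lemma real_polynomial_norm_form: "real_polynomial_function (\<lambda>x. (norm (H x y))\<^sup>2)"
  unfolding cmod_power2 using linear_Re_form linear_Im_form
  by (intro real_polynomial_function.intros(3) real_polynomial_function_power real_polynomial_function.intros(1))
    (simp_all add: linear_conv_bounded_linear)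

end

text \<open>After division by \<open>- y4\<close> the first three become unit numbers with weighted
  mean \<open>1\<close>. Real parts of unit numbers are at most \<open>1\<close>, so all of them
  equal \<open>1\<close>.\<close>

lemma equality_in_triangle_inequality:
  fixes y1 y2 y3 y4 :: complex
  assumes "a > 0" "b > 0" "c > 0" and n: "norm y1 = 1" "norm y2 = 1" "norm y3 = 1" "norm y4 = 1"
    and eq: "a * y1 + b * y2 + c * y3 + complex_of_real (a + b + c) * y4 = 0"
  shows "y1 = - y4" "y2 = - y4" "y3 = - y4"
proof -
  define z where "z y = - y * cnj y4" for y
  have y4: "y4 * cnj y4 = 1"
    using n by (simp add: complex_norm_square[symmetric])
  have "a * z y1 + b * z y2 + c * z y3 =
    - cnj y4 * (a * y1 + b * y2 + c * y3 + complex_of_real (a + b + c) * y4) + complex_of_real (a + b + c) * (y4 * cnj y4)"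
    by (simp add: z_def algebra_simps)
  then have sum: "a * z y1 + b * z y2 + c * z y3 = complex_of_real (a + b + c)"
    unfolding eq y4 by simp
  have nz: "norm (z y1) = 1" "norm (z y2) = 1" "norm (z y3) = 1"
    using n by (simp_all add: z_def norm_mult)
  then have le: "Re (z y1) \<le> 1" "Re (z y2) \<le> 1" "Re (z y3) \<le> 1"
    by (metis complex_Re_le_cmod)+
  have "a * (1 - Re (z y1)) + b * (1 - Re (z y2)) + c * (1 - Re (z y3)) = 0"
    using arg_cong[OF sum, of Re] by (simp add: algebra_simps)
  moreover have "a * (1 - Re (z y1)) \<ge> 0" "b * (1 - Re (z y2)) \<ge> 0" "c * (1 - Re (z y3)) \<ge> 0"
    using assms(1-3) le by simp_all
  ultimately have "a * (1 - Re (z y1)) = 0" "b * (1 - Re (z y2)) = 0" "c * (1 - Re (z y3)) = 0"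
    by linarith+
  then have re: "Re (z y1) = 1" "Re (z y2) = 1" "Re (z y3) = 1"
    using assms(1-3) by simp_all
  have one: "w = 1" if "norm w = 1" "Re w = 1" for w
    using that cmod_power2[of w] by (simp add: complex_eq_iff)
  have y_eq: "y = - y4" if "z y = 1" for y
  proof -
    have "y * (y4 * cnj y4) = - y4 * z y"
      by (simp add: z_def)
    then show ?thesis
      by (simp add: y4 that)
  qed
  show "y1 = - y4" "y2 = - y4" "y3 = - y4"
    using one nz re y_eq by auto
qed

context hermitian_ppm
begin

text \<open>If \<open>d = a + b + c\<close>, then \<open>- P4\<close> is a convex combination of the other three points; but the
  points have the same norm and the same product with \<open>q\<close>, so they lie on a sphere in a translate of the
  positive definite space orthogonal to \<open>q\<close>, and a sphere is strictly convex.\<close>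

lemma no_convex_relation:
  assumes q: "Re (H q q) < 0"
    and n: "norm (H q P1) = 1" "norm (H q P2) = 1" "norm (H q P3) = 1" "norm (H q P4) = 1"
    and \<sigma>: "H P1 P1 = \<sigma>" "H P2 P2 = \<sigma>" "H P3 P3 = \<sigma>" "H P4 P4 = \<sigma>"
    and pos: "a > 0" "b > 0" "c > 0"
    and rel: "complex_of_real a *s P1 + complex_of_real b *s P2 + complex_of_real c *s P3 + complex_of_real d *s P4 = 0"
    and "P1 + P4 \<noteq> 0"
  shows "d \<noteq> a + b + c"
proof
  assume d: "d = a + b + c"
  have n': "norm (H P1 q) = 1" "norm (H P2 q) = 1" "norm (H P3 q) = 1" "norm (H P4 q) = 1"
    using n H_sym by (metis complex_mod_cnj)+
  have "a * H P1 q + b * H P2 q + c * H P3 q + complex_of_real (a + b + c) * H P4 q = 0"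
    using arg_cong[OF rel, of "\<lambda>x. H x q"] by (simp add: form_simps d algebra_simps)
  note y = equality_in_triangle_inequality[OF pos n' this]
  \<comment> \<open>The differences between \<open>P1\<close>, \<open>P2\<close>, \<open>P3\<close>
    and \<open>- P4\<close>; equality in the triangle inequality makes them orthogonal to
    \<open>q\<close>.\<close>
  define x1 x2 x3 where "x1 = P1 + P4" and "x2 = P2 + P4" and "x3 = P3 + P4"
  have orth: "H x1 q = 0" "H x2 q = 0" "H x3 q = 0"
    using y by (simp_all add: x1_def x2_def x3_def form_simps)
  have nonneg: "Re (H x x) \<ge> 0" if "H x q = 0" for x
    using orthogonal_negative_positive[OF q that] by (cases "x = 0") (auto simp: form_simps)
  \<comment> \<open>Both vectors have square \<open>\<sigma>\<close>. Hence pairing the relation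
    among the \<open>x\<close>'s with \<open>P4\<close> yields a vanishing positive combination of
    their nonnegative squares.\<close>
  have self: "Re (H (P + P4) (P + P4)) = 2 * Re (H (P + P4) P4)" if "H P P = \<sigma>" for P
    using that \<sigma>(4) H_sym[of P4 P] by (simp add: form_simps)
  have "complex_of_real a *s x1 + complex_of_real b *s x2 + complex_of_real c *s x3 =
    complex_of_real a *s P1 + complex_of_real b *s P2 + complex_of_real c *s P3 + complex_of_real d *s P4"
    by (simp add: x1_def x2_def x3_def d vec.scale_right_distrib vec.scale_left_distrib ac_simps)
  then have sum0: "complex_of_real a *s x1 + complex_of_real b *s x2 + complex_of_real c *s x3 = 0"
    using rel by simp
  have "a * H x1 P4 + b * H x2 P4 + c * H x3 P4 = 0"
    using arg_cong[OF sum0, of "\<lambda>x. H x P4"] by (simp add: form_simps)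
  then have "a * Re (H x1 P4) + b * Re (H x2 P4) + c * Re (H x3 P4) = 0"
    by (auto dest: arg_cong[of _ _ Re])
  then have "a * Re (H x1 x1) + b * Re (H x2 x2) + c * Re (H x3 x3) = 0"
    unfolding x1_def x2_def x3_def self[OF \<sigma>(1)] self[OF \<sigma>(2)] self[OF \<sigma>(3)] by (simp add: algebra_simps)
  moreover have "a * Re (H x1 x1) \<ge> 0" "b * Re (H x2 x2) \<ge> 0" "c * Re (H x3 x3) \<ge> 0"
    using nonneg orth pos by simp_all
  ultimately have "a * Re (H x1 x1) = 0"
    by linarith
  then have "Re (H x1 x1) = 0"
    using pos by simp
  then have "x1 = 0"
    using orthogonal_negative_positive[OF q orth(1)] by auto
  then show False
    using \<open>P1 + P4 \<noteq> 0\<close> by (simp add: x1_def)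
qed

end

section \<open>The base of an equitant family\<close>

text \<open>A factor that vanishes at \<open>0\<close> can be constant on \<open>W\<close> only by
  being zero there; then the cubic is constant, which irreducibility forbids.\<close>

lemma not_irreducible_cubicI:
  assumes "0 \<in> W" "real_polynomial_function f" "real_polynomial_function g" "f 0 = 0" "g 0 = 0"
    and eq: "\<And>h. h \<in> W \<Longrightarrow> Re (det h) = f h * g h"
  shows "\<not> irreducible_cubic W"
proof
  assume "irreducible_cubic W"
  then have nonconst: "\<not> (\<exists>k. \<forall>h\<in>W. Re (det h) = k)"
    and "(\<exists>k. \<forall>h\<in>W. f h = k) \<or> (\<exists>k. \<forall>h\<in>W. g h = k)"
    using assms(2,3) eq unfolding irreducible_cubic_def irreducible_polynomial_on_def by blast+
  then have "(\<forall>h\<in>W. f h = 0) \<or> (\<forall>h\<in>W. g h = 0)"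
    using assms(1,4,5) by metis
  then have "\<forall>h\<in>W. Re (det h) = 0"
    using eq by auto
  then show False
    using nonconst by blast
qed

context hermitian_ppm
begin

text \<open>Pairing with three vectors becomes a matrix action, so that injectivity yields
  surjectivity and determinants multiply.\<close>

lemma form_matrix_mult: "((\<chi> i k. H (axis k 1) (Y i)) :: endo) *v x = (\<chi> i. H x (Y i))"
proof -
  have "H x y = (\<Sum>k\<in>UNIV. H (axis k 1) y * x $ k)" for y
    using arg_cong[OF basis_expansion[of x], of "\<lambda>x. H x y"]
    by (simp add: sum_left smult_left mult.commute)
  then show ?thesis
    by (simp add: vec_eq_iff matrix_vector_mult_def)
qed

lemma linear_Re_form_mult: "linear (\<lambda>h. Re (H (h *v x) y))" for x :: V
  by (rule linearI) (simp_all add: matrix_vector_mult_add_rdistrib scaleR_matrix_vector scaleR_eq_smult form_simps)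

lemma real_polynomial_Re_form_mult: "real_polynomial_function (\<lambda>h. Re (H (h *v x) y))" for x :: V
  using linear_Re_form_mult[of x y] by (simp add: linear_conv_bounded_linear real_polynomial_function.intros(1))

end

section \<open>Coordinates dual to three of the four points\<close>

locale equitant_points = hermitian_ppm H + quadrilateral a b c d
  for H and a b c d :: real +
  fixes P1 P2 P3 P4 :: V
  assumes relation: "complex_of_real a *s P1 + complex_of_real b *s P2 + complex_of_real c *s P3 +
      complex_of_real d *s P4 = 0"
    and independent: "r *s P1 + s *s P2 + t *s P3 = 0 \<Longrightarrow> r = 0 \<and> s = 0 \<and> t = 0"
begin

lemma coordinates_zero:
  assumes "H x P1 = 0" "H x P2 = 0" "H x P3 = 0"
  shows "x = 0"
proof (rule nondegenerate)
  fix y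
  obtain r s t where "y = r *s P1 + s *s P2 + t *s P3"
    by (rule independent_triple_spans[OF independent])
  then show "H x y = 0"
    using assms by (simp add: form_simps)
qed

lemma coordinate4: "H x P4 = - (a * H x P1 + b * H x P2 + c * H x P3) / d"
proof -
  have "a * H x P1 + b * H x P2 + c * H x P3 + d * H x P4 = 0"
    using arg_cong[OF relation, of "H x"] by (simp add: form_simps)
  then have "d * H x P4 = - (a * H x P1 + b * H x P2 + c * H x P3)"
    by (simp only: add_eq_0_iff2 add.commute)
  then show ?thesis
    using pos by (simp add: field_simps)
qed

lemma dual_exists: "\<exists>x. H x P1 = r \<and> H x P2 = s \<and> H x P3 = t"
proof -
  let ?Y = "\<lambda>i :: 3. if i = 1 then P1 else if i = 2 then P2 else P3"
  let ?M = "(\<chi> i k. H (axis k 1) (?Y i)) :: endo"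
  have "\<forall>v. ?M *v v = 0 \<longrightarrow> v = 0"
  proof (intro allI impI)
    fix x assume "?M *v x = 0"
    then have 0: "\<forall>i. H x (?Y i) = 0"
      unfolding form_matrix_mult by (simp add: vec_eq_iff)
    show "x = 0"
      by (rule coordinates_zero) (use 0[rule_format, of 1] 0[rule_format, of 2] 0[rule_format, of 3] in simp_all)
  qed
  then have "\<exists>B. B ** ?M = mat 1"
    by (simp add: matrix_left_invertible_ker)
  then have "\<exists>B. ?M ** B = mat 1"
    by (simp add: matrix_left_right_inverse)
  then have "surj ((*v) ?M)"
    by (simp add: matrix_right_invertible_surjective)
  then obtain x where x: "(\<chi> i. if i = 1 then r else if i = 2 then s else t) = ?M *v x"
    by (rule surjE)
  then have 1: "\<forall>i. H x (?Y i) = (if i = 1 then r else if i = 2 then s else t)"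
    unfolding form_matrix_mult by (simp add: vec_eq_iff)
  show ?thesis
    by (rule exI[of _ x]) (use 1[rule_format, of 1] 1[rule_format, of 2] 1[rule_format, of 3] in simp_all)
qed

definition dual :: "3 \<Rightarrow> V" where
  "dual i = (SOME x. H x P1 = of_bool (i = 1) \<and> H x P2 = of_bool (i = 2) \<and> H x P3 = of_bool (i = 3))"

lemma dual: "H (dual i) P1 = of_bool (i = 1)" "H (dual i) P2 = of_bool (i = 2)" "H (dual i) P3 = of_bool (i = 3)"
proof -
  have "H (dual i) P1 = of_bool (i = 1) \<and> H (dual i) P2 = of_bool (i = 2) \<and> H (dual i) P3 = of_bool (i = 3)"
    unfolding dual_def by (rule someI_ex[OF dual_exists])
  then show "H (dual i) P1 = of_bool (i = 1)" "H (dual i) P2 = of_bool (i = 2)" "H (dual i) P3 = of_bool (i = 3)"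
    by simp_all
qed

lemma dual4: "H (dual 1) P4 = - a / d" "H (dual 2) P4 = - b / d" "H (dual 3) P4 = - c / d"
  by (simp_all add: coordinate4 dual)

lemma dual_expansion: "x = H x P1 *s dual 1 + H x P2 *s dual 2 + H x P3 *s dual 3"
proof -
  have "x - (H x P1 *s dual 1 + H x P2 *s dual 2 + H x P3 *s dual 3) = 0"
    by (rule coordinates_zero) (simp_all add: form_simps dual)
  then show ?thesis
    by (simp only: right_minus_eq)
qed

section \<open>The points with equal moduli, parametrised by the linkage\<close>

definition equimodular :: "V set set" where
  "equimodular = {L \<in> proj_plane. \<forall>x\<in>L. norm (H x P2) = norm (H x P1) \<and>
     norm (H x P3) = norm (H x P1) \<and> norm (H x P4) = norm (H x P1)}"

definition point :: "complex \<times> complex \<Rightarrow> V" where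
  "point x = fst x *s dual 1 + snd x *s dual 2 + dual 3"

lemma point_coordinates:
  "H (point x) P1 = fst x" "H (point x) P2 = snd x" "H (point x) P3 = 1"
  "H (point x) P4 = - (a * fst x + b * snd x + c) / d" for x :: "complex \<times> complex"
  by (simp_all add: point_def coordinate4 form_simps dual)

lemma point_neq_0: "point x \<noteq> 0"
  using point_coordinates(3)[of x] by (auto simp: form_simps)

lemma inj_point: "inj (\<lambda>x. vec.span {point x})"
proof (rule injI)
  fix x y assume eq: "vec.span {point x} = vec.span {point y}"
  have "point x \<in> vec.span {point y}"
    using eq vec.span_base[of "point x" "{point x}"] by simp
  then obtain k where k: "point x = k *s point y"
    by (auto simp: vec.span_singleton)
  have "k = 1"
    using arg_cong[OF k, of "\<lambda>x. H x P3"] by (simp add: form_simps point_coordinates)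
  then show "x = y"
    using arg_cong[OF k, of "\<lambda>x. H x P1"] arg_cong[OF k, of "\<lambda>x. H x P2"]
    by (simp add: point_coordinates prod_eq_iff)
qed

lemma point_mem_equimodular:
  assumes "x \<in> linkage"
  shows "vec.span {point x} \<in> equimodular"
proof -
  have x: "norm (fst x) = 1" "norm (snd x) = 1" "norm (a * fst x + b * snd x + c) = d"
    using assms by (auto simp: linkage_def)
  have n4: "norm (H (point x) P4) = 1"
    unfolding point_coordinates norm_divide norm_minus_cancel x(3) using pos by simp
  have "norm (H (k *s point x) P2) = norm (H (k *s point x) P1) \<and>
      norm (H (k *s point x) P3) = norm (H (k *s point x) P1) \<and>
      norm (H (k *s point x) P4) = norm (H (k *s point x) P1)" for k
    using x n4 by (simp add: smult_left norm_mult point_coordinates(1-3))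
  then show ?thesis
    unfolding equimodular_def proj_plane_def using point_neq_0[of x] by (auto simp: vec.span_singleton)
qed

text \<open>Scaling to \<open>H x P3 = 1\<close> turns the equal moduli into
  \<open>|u| = |v| = 1\<close> and, by \<open>coordinate4\<close>, into
  \<open>|a u + b v + c| = d\<close>. It is possible because a vanishing common modulus would make
  the vector orthogonal to \<open>P1\<close>, \<open>P2\<close>, \<open>P3\<close>.\<close>

lemma equimodular_eq: "equimodular = (\<lambda>x. vec.span {point x}) ` linkage"
proof (intro subset_antisym subsetI)
  fix L assume "L \<in> equimodular"
  then have L: "L \<in> proj_plane" and eq: "\<And>x. x \<in> L \<Longrightarrow> norm (H x P2) = norm (H x P1) \<and>
     norm (H x P3) = norm (H x P1) \<and> norm (H x P4) = norm (H x P1)"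
    by (auto simp: equimodular_def)
  obtain v where v: "v \<noteq> 0" "L = vec.span {v}"
    using L by (auto simp: proj_plane_def)
  then have "v \<in> L"
    using vec.span_base[of v] by simp
  have "H v P3 \<noteq> 0"
    using eq[OF \<open>v \<in> L\<close>] coordinates_zero[of v] v by auto
  define w where "w = inverse (H v P3) *s v"
  have "w \<in> L"
    using L \<open>v \<in> L\<close> unfolding w_def by (rule smult_mem_proj_plane)
  have w3: "H w P3 = 1"
    using \<open>H v P3 \<noteq> 0\<close> by (simp add: w_def form_simps)
  let ?x = "(H w P1, H w P2)"
  have w: "w = point ?x"
    using dual_expansion[of w] by (simp add: point_def w3)
  have "norm (- (a * H w P1 + b * H w P2 + c) / d) = 1"
    using eq[OF \<open>w \<in> L\<close>] by (simp add: coordinate4 w3)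
  then have "norm (a * H w P1 + b * H w P2 + c) = d"
    using pos by (simp only: norm_divide norm_minus_cancel norm_of_real) (simp add: divide_eq_1_iff)
  then have "?x \<in> linkage"
    using eq[OF \<open>w \<in> L\<close>] w3 by (simp add: linkage_def)
  moreover have "vec.span {w} = L"
  proof (rule proj_plane_subset_eq[OF _ L])
    show "vec.span {w} \<in> proj_plane"
      using point_neq_0 w unfolding proj_plane_def by auto
    show "vec.span {w} \<subseteq> L"
      using \<open>w \<in> L\<close> v by (metis empty_subsetI insert_subset vec.span_minimal vec.subspace_span)
  qed
  ultimately show "L \<in> (\<lambda>x. vec.span {point x}) ` linkage"
    using w by force
next
  fix L assume "L \<in> (\<lambda>x. vec.span {point x}) ` linkage"
  then show "L \<in> equimodular"
    using point_mem_equimodular by blast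
qed

lemma real_algebraic_equimodular: "real_algebraic equimodular"
proof -
  define F where "F = (\<lambda>Y x. (norm (H x Y))\<^sup>2 - (norm (H x P1))\<^sup>2) ` {P2, P3, P4}"
  have "real_polynomial_function f" if "f \<in> F" for f
    using that real_polynomial_norm_form by (auto simp: F_def intro!: real_polynomial_function_diff)
  then show ?thesis
    by (rule real_algebraicI[of F]) (auto simp: equimodular_def F_def)
qed

lemma polynomial_function_point: "polynomial_function (\<lambda>x. k *s point x)"
proof -
  have "linear (\<lambda>x. fst x *s (k *s dual 1) + snd x *s (k *s dual 2))"
    by (rule linearI) (auto simp: vec_eq_iff algebra_simps scaleR_conv_of_real[where 'a = complex])
  then have "polynomial_function (\<lambda>x. (fst x *s (k *s dual 1) + snd x *s (k *s dual 2)) + k *s dual 3)"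
    unfolding linear_conv_bounded_linear
    by (intro polynomial_function_add[OF polynomial_function_bounded_linear polynomial_function_const])
  moreover have "k *s point x = (fst x *s (k *s dual 1) + snd x *s (k *s dual 2)) + k *s dual 3" for x
    by (simp add: point_def vec_eq_iff algebra_simps)
  ultimately show ?thesis
    by simp
qed

lemma irreducible_equimodular:
  assumes "non_kite a b c d" "infinite linkage"
  shows "irreducible_algebraic_curve equimodular"
proof (rule irreducible_algebraic_curveI)
  interpret non_kite a b c d by fact
  show "infinite equimodular"
  proof
    assume "finite equimodular"
    then have "finite linkage"
      unfolding equimodular_eq by (rule finite_imageD) (rule inj_on_subset[OF inj_point subset_UNIV])
    then show False
      using assms(2) by simp
  qed
  fix f :: "V \<Rightarrow> real" and L p
  assume f: "real_polynomial_function f" and L: "L \<in> equimodular" "p \<in> L" "f p \<noteq> 0"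
  obtain x0 where x0: "x0 \<in> linkage" "L = vec.span {point x0}"
    using L(1) unfolding equimodular_eq by blast
  then obtain k where k: "p = k *s point x0"
    using L(2) by (auto simp: vec.span_singleton)
  \<comment> \<open>\<open>f\<close> need not be homogeneous, so the scale \<open>k\<close> at which
    it is nonzero on \<open>L\<close> is kept fixed; a line on which \<open>f\<close> vanishes
    entirely still gives a zero of \<open>\<phi>\<close>.\<close>
  define \<phi> where "\<phi> x = f (k *s point x)" for x
  have "real_polynomial_function \<phi>"
    using real_polynomial_function_compose[OF polynomial_function_point[of k] f]
    by (simp add: \<phi>_def[abs_def] o_def)
  moreover have "\<phi> x0 \<noteq> 0"
    using L(3) k by (simp add: \<phi>_def)
  ultimately have "finite {x \<in> linkage. \<phi> x = 0}"
    using linkage_zeros x0(1) by blast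
  moreover have "{L \<in> equimodular. \<forall>p\<in>L. f p = 0} \<subseteq> (\<lambda>x. vec.span {point x}) ` {x \<in> linkage. \<phi> x = 0}"
    unfolding equimodular_eq \<phi>_def by (auto intro!: imageI simp: vec.span_scale vec.span_base)
  ultimately show "finite {L \<in> equimodular. \<forall>p\<in>L. f p = 0}"
    by (meson finite_imageI finite_subset)
qed (rule real_algebraic_equimodular)

section \<open>The family, its base and its cubic\<close>

definition combination :: "real \<Rightarrow> real \<Rightarrow> real \<Rightarrow> real \<Rightarrow> endo" where
  "combination r1 r2 r3 r4 = r1 *\<^sub>R rank_one H P1 P1 + r2 *\<^sub>R rank_one H P2 P2 +
     r3 *\<^sub>R rank_one H P3 P3 + r4 *\<^sub>R rank_one H P4 P4"

definition family :: "endo set" where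
  "family = {combination r1 r2 r3 r4 | r1 r2 r3 r4. r1 + r2 + r3 + r4 = 0}"

lemma form_combination: "H (combination r1 r2 r3 r4 *v x) y =
  r1 * (H x P1 * cnj (H y P1)) + r2 * (H x P2 * cnj (H y P2)) +
  r3 * (H x P3 * cnj (H y P3)) + r4 * (H x P4 * cnj (H y P4))"
  by (simp add: combination_def matrix_vector_mult_add_rdistrib scaleR_matrix_vector scaleR_eq_smult rank_one_mult
      form_simps H_sym[of P1 y] H_sym[of P2 y] H_sym[of P3 y] H_sym[of P4 y])

lemma zero_mem_family: "0 \<in> family"
  unfolding family_def by (auto intro!: exI[of _ 0] simp: combination_def)

lemma base_family: "base H family = equimodular"
proof -
  have "(\<forall>h\<in>family. H (h *v x) x = 0) \<longleftrightarrow> norm (H x P2) = norm (H x P1) \<and>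
     norm (H x P3) = norm (H x P1) \<and> norm (H x P4) = norm (H x P1)" for x
  proof -
    have form: "H (combination r1 r2 r3 r4 *v x) x = complex_of_real
      (r1 * (norm (H x P1))\<^sup>2 + r2 * (norm (H x P2))\<^sup>2 + r3 * (norm (H x P3))\<^sup>2 + r4 * (norm (H x P4))\<^sup>2)"
      for r1 r2 r3 r4
      unfolding form_combination by (simp only: complex_norm_square[symmetric] of_real_mult of_real_add)
    show ?thesis
    proof
      assume 0: "\<forall>h\<in>family. H (h *v x) x = 0"
      have "combination 1 (-1) 0 0 \<in> family" "combination 1 0 (-1) 0 \<in> family" "combination 1 0 0 (-1) \<in> family"
        unfolding family_def by force+
      from this[THEN bspec[OF 0]] show "norm (H x P2) = norm (H x P1) \<and>
        norm (H x P3) = norm (H x P1) \<and> norm (H x P4) = norm (H x P1)"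
        unfolding form of_real_eq_0_iff by simp
    next
      assume eq: "norm (H x P2) = norm (H x P1) \<and> norm (H x P3) = norm (H x P1) \<and> norm (H x P4) = norm (H x P1)"
      show "\<forall>h\<in>family. H (h *v x) x = 0"
      proof
        fix h assume "h \<in> family"
        then obtain r1 r2 r3 r4 where h: "h = combination r1 r2 r3 r4" "r1 + r2 + r3 + r4 = 0"
          unfolding family_def by blast
        have "H (h *v x) x = complex_of_real ((r1 + r2 + r3 + r4) * (norm (H x P1))\<^sup>2)"
          unfolding h(1) form using eq by (simp add: algebra_simps)
        then show "H (h *v x) x = 0"
          by (simp add: h(2))
      qed
    qed
  qed
  then show ?thesis
    unfolding base_def equimodular_def by simp
qed

text \<open>The matrix on the right is \<open>?M ** (h ** ?E)\<close> with \<open>?M\<close> and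
  \<open>?E\<close> invertible and independent of \<open>h\<close>. The cubic can thus be computed
  in the dual basis.\<close>

lemma det_gram: "\<exists>k. \<forall>h. det h = k * det (\<chi> i j. H (h *v dual j) (dual i))"
proof -
  let ?M = "(\<chi> i k. H (axis k 1) (dual i)) :: endo"
  let ?E = "(\<chi> k j. dual j $ k) :: endo"
  have comp: "(A ** B) $ i $ j = (A *v column j B) $ i" for A B :: endo and i j
    by (simp add: matrix_matrix_mult_def matrix_vector_mult_def column_def)
  have col: "column j (A ** B) = A *v column j B" for A B :: endo and j
    by (simp add: vec_eq_iff matrix_matrix_mult_def matrix_vector_mult_def column_def)
  have "column j ?E = dual j" for j
    by (simp add: vec_eq_iff column_def)
  then have "(?M ** (h ** ?E)) $ i $ j = H (h *v dual j) (dual i)" for h :: endo and i j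
    unfolding comp[of ?M] col[of _ h] form_matrix_mult by simp
  then have "(\<chi> i j. H (h *v dual j) (dual i)) = ?M ** (h ** ?E)" for h :: endo
    by (simp only: vec_eq_iff vec_lambda_beta) simp
  then have gram: "det (\<chi> i j. H (h *v dual j) (dual i)) = det ?M * (det h * det ?E)" for h
    by (simp only: det_mul)
  have "\<forall>x. ?M *v x = 0 \<longrightarrow> x = 0"
  proof (intro allI impI nondegenerate)
    fix x y assume "?M *v x = 0"
    then have 0: "\<forall>i. H x (dual i) = 0"
      unfolding form_matrix_mult by (simp add: vec_eq_iff)
    show "H x y = 0"
      by (subst dual_expansion[of y]) (simp add: form_simps 0)
  qed
  then have "det ?M \<noteq> 0"
    by (simp add: invertible_det_nz[symmetric] invertible_left_inverse matrix_left_invertible_ker)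
  moreover have "\<forall>x. ?E *v x = 0 \<longrightarrow> x = 0"
  proof (intro allI impI)
    fix x assume 0: "?E *v x = 0"
    have "?E *v x = x $ 1 *s dual 1 + x $ 2 *s dual 2 + x $ 3 *s dual 3"
      by (simp add: vec_eq_iff matrix_vector_mult_def sum_3 mult.commute)
    then have "x $ 1 *s dual 1 + x $ 2 *s dual 2 + x $ 3 *s dual 3 = 0"
      using 0 by simp
    from this[THEN arg_cong, of "\<lambda>x. H x P1"] this[THEN arg_cong, of "\<lambda>x. H x P2"]
      this[THEN arg_cong, of "\<lambda>x. H x P3"]
    show "x = 0"
      by (simp add: form_simps dual vec_eq_iff forall_3)
  qed
  then have "det ?E \<noteq> 0"
    by (simp add: invertible_det_nz[symmetric] invertible_left_inverse matrix_left_invertible_ker)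
  ultimately show ?thesis
    by (intro exI[of _ "inverse (det ?M * det ?E)"]) (simp add: gram field_simps)
qed

text \<open>In the dual basis the operators of \<open>P1\<close>, \<open>P2\<close>,
  \<open>P3\<close> become diagonal matrix units, and that of \<open>P4\<close> becomes the product
  of the column \<open>(a, b, c) / d\<close> with its transpose.\<close>

lemma det_combination: "\<exists>k. \<forall>r1 r2 r3 r4. Re (det (combination r1 r2 r3 r4)) =
  k * (d\<^sup>2 * r1 * r2 * r3 + r4 * (a\<^sup>2 * r2 * r3 + b\<^sup>2 * r1 * r3 + c\<^sup>2 * r1 * r2))"
proof -
  obtain k where k: "\<And>h. det h = k * det (\<chi> i j. H (h *v dual j) (dual i))"
    using det_gram by blast
  have re: "Re (z * complex_of_real x) = Re z * x" for z x
    by simp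
  have D: "det (\<chi> i j. H (combination r1 r2 r3 r4 *v dual j) (dual i)) = complex_of_real
    ((d\<^sup>2 * r1 * r2 * r3 + r4 * (a\<^sup>2 * r2 * r3 + b\<^sup>2 * r1 * r3 + c\<^sup>2 * r1 * r2)) / d\<^sup>2)" for r1 r2 r3 r4
    using pos by (simp add: det_3 form_combination dual dual4 field_simps power2_eq_square)
  have "Re (det (combination r1 r2 r3 r4)) = Re k / d\<^sup>2 *
    (d\<^sup>2 * r1 * r2 * r3 + r4 * (a\<^sup>2 * r2 * r3 + b\<^sup>2 * r1 * r3 + c\<^sup>2 * r1 * r2))" for r1 r2 r3 r4
    unfolding k[of "combination r1 r2 r3 r4"] D re by simp
  then show ?thesis
    by blast
qed

text \<open>Factors of the cubic have to be polynomials in the endomorphism, so the coefficients are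
  recovered from it: the off-diagonal entry for \<open>dual 1\<close>, \<open>dual 2\<close> is
  \<open>r4 a b / d\<^sup>2\<close>, and removing the share of \<open>r4\<close> from the diagonal
  entries leaves the others.\<close>

lemma coefficient_functions:
  obtains \<rho>1 \<rho>2 \<rho>3 \<rho>4 where
    "real_polynomial_function \<rho>1" "real_polynomial_function \<rho>2"
    "real_polynomial_function \<rho>3" "real_polynomial_function \<rho>4"
    "\<And>r1 r2 r3 r4. \<rho>1 (combination r1 r2 r3 r4) = r1" "\<And>r1 r2 r3 r4. \<rho>2 (combination r1 r2 r3 r4) = r2"
    "\<And>r1 r2 r3 r4. \<rho>3 (combination r1 r2 r3 r4) = r3" "\<And>r1 r2 r3 r4. \<rho>4 (combination r1 r2 r3 r4) = r4"
proof -
  let ?r4 = "\<lambda>h. Re (H (h *v dual 1) (dual 2)) * (d\<^sup>2 / (a * b))"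
  let ?r = "\<lambda>i k h. Re (H (h *v dual i) (dual i)) - ?r4 h * (k\<^sup>2 / d\<^sup>2)"
  show ?thesis
  proof (rule that[of "?r 1 a" "?r 2 b" "?r 3 c" ?r4])
    show "real_polynomial_function (?r 1 a)" "real_polynomial_function (?r 2 b)"
      "real_polynomial_function (?r 3 c)" "real_polynomial_function ?r4"
      by (intro real_polynomial_function_diff real_polynomial_Re_form_mult real_polynomial_function.intros(2,4))+
    show "?r 1 a (combination r1 r2 r3 r4) = r1" "?r 2 b (combination r1 r2 r3 r4) = r2"
      "?r 3 c (combination r1 r2 r3 r4) = r3" "?r4 (combination r1 r2 r3 r4) = r4" for r1 r2 r3 r4
      using pos by (simp_all add: form_combination dual dual4 power2_eq_square field_simps)
  qed
qed

text \<open>Up to a constant the cubic is the sum of the squared sides, each times the product of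
  the other three coefficients. If \<open>a = b\<close> and \<open>c = d\<close>, it is
  \<open>a\<^sup>2 r3 r4 (r1 + r2) + c\<^sup>2 r1 r2 (r3 + r4)\<close>, and
  \<open>r3 + r4 = - (r1 + r2)\<close> splits off a linear factor. The other pairings are
  analogous.\<close>

lemma non_kite_if_irreducible:
  assumes "irreducible_cubic family"
  shows "non_kite a b c d"
proof (rule ccontr)
  assume "\<not> non_kite a b c d"
  then have kite: "a = b \<and> c = d \<or> a = c \<and> b = d \<or> a = d \<and> b = c"
    unfolding non_kite_def non_kite_axioms_def using quadrilateral_axioms by blast
  obtain \<rho>1 \<rho>2 \<rho>3 \<rho>4 where poly: "real_polynomial_function \<rho>1" "real_polynomial_function \<rho>2"
    "real_polynomial_function \<rho>3" "real_polynomial_function \<rho>4" and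
    \<rho>: "\<And>r1 r2 r3 r4. \<rho>1 (combination r1 r2 r3 r4) = r1" "\<And>r1 r2 r3 r4. \<rho>2 (combination r1 r2 r3 r4) = r2"
    "\<And>r1 r2 r3 r4. \<rho>3 (combination r1 r2 r3 r4) = r3" "\<And>r1 r2 r3 r4. \<rho>4 (combination r1 r2 r3 r4) = r4"
    by (rule coefficient_functions) blast
  obtain k where k: "\<And>r1 r2 r3 r4. Re (det (combination r1 r2 r3 r4)) =
    k * (d\<^sup>2 * r1 * r2 * r3 + r4 * (a\<^sup>2 * r2 * r3 + b\<^sup>2 * r1 * r3 + c\<^sup>2 * r1 * r2))"
    using det_combination by blast
  have reducible: False
    if f: "\<And>r1 r2 r3 r4. r1 + r2 + r3 + r4 = 0 \<Longrightarrow> f (combination r1 r2 r3 r4) * g (combination r1 r2 r3 r4) =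
      k * (d\<^sup>2 * r1 * r2 * r3 + r4 * (a\<^sup>2 * r2 * r3 + b\<^sup>2 * r1 * r3 + c\<^sup>2 * r1 * r2))"
      and "real_polynomial_function f" "real_polynomial_function g"
      and 0: "f (combination 0 0 0 0) = 0" "g (combination 0 0 0 0) = 0" for f g
  proof -
    have "combination 0 0 0 0 = 0"
      by (simp add: combination_def)
    moreover have "Re (det h) = f h * g h" if "h \<in> family" for h
      using that f unfolding family_def by (auto simp: k)
    ultimately show False
      using not_irreducible_cubicI[OF zero_mem_family, of f g] that(2,3) 0 assms by simp
  qed
  note intros = poly real_polynomial_function.intros(2,3,4) real_polynomial_function_diff
  from kite show False
  proof (elim disjE conjE)
    assume eq: "a = b" "c = d"
    show False
    proof (rule reducible[of "\<lambda>h. \<rho>1 h + \<rho>2 h"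
          "\<lambda>h. k * (a\<^sup>2 * (\<rho>3 h * \<rho>4 h) - c\<^sup>2 * (\<rho>1 h * \<rho>2 h))"])
      fix r1 r2 r3 r4 :: real assume "r1 + r2 + r3 + r4 = 0"
      then have r4: "r4 = - (r1 + r2 + r3)"
        by simp
      show "(\<rho>1 (combination r1 r2 r3 r4) + \<rho>2 (combination r1 r2 r3 r4)) *
          (k * (a\<^sup>2 * (\<rho>3 (combination r1 r2 r3 r4) * \<rho>4 (combination r1 r2 r3 r4)) -
            c\<^sup>2 * (\<rho>1 (combination r1 r2 r3 r4) * \<rho>2 (combination r1 r2 r3 r4)))) =
        k * (d\<^sup>2 * r1 * r2 * r3 + r4 * (a\<^sup>2 * r2 * r3 + b\<^sup>2 * r1 * r3 + c\<^sup>2 * r1 * r2))"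
        unfolding \<rho> r4 eq by (simp add: algebra_simps)
    qed (simp_all only: \<rho>, (intro intros)+, simp_all)
  next
    assume eq: "a = c" "b = d"
    show False
    proof (rule reducible[of "\<lambda>h. \<rho>1 h + \<rho>3 h"
          "\<lambda>h. k * (a\<^sup>2 * (\<rho>2 h * \<rho>4 h) - b\<^sup>2 * (\<rho>1 h * \<rho>3 h))"])
      fix r1 r2 r3 r4 :: real assume "r1 + r2 + r3 + r4 = 0"
      then have r4: "r4 = - (r1 + r2 + r3)"
        by simp
      show "(\<rho>1 (combination r1 r2 r3 r4) + \<rho>3 (combination r1 r2 r3 r4)) *
          (k * (a\<^sup>2 * (\<rho>2 (combination r1 r2 r3 r4) * \<rho>4 (combination r1 r2 r3 r4)) -
            b\<^sup>2 * (\<rho>1 (combination r1 r2 r3 r4) * \<rho>3 (combination r1 r2 r3 r4)))) =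
        k * (d\<^sup>2 * r1 * r2 * r3 + r4 * (a\<^sup>2 * r2 * r3 + b\<^sup>2 * r1 * r3 + c\<^sup>2 * r1 * r2))"
        unfolding \<rho> r4 eq by (simp add: algebra_simps)
    qed (simp_all only: \<rho>, (intro intros)+, simp_all)
  next
    assume eq: "a = d" "b = c"
    show False
    proof (rule reducible[of "\<lambda>h. \<rho>1 h + \<rho>4 h"
          "\<lambda>h. k * (a\<^sup>2 * (\<rho>2 h * \<rho>3 h) - b\<^sup>2 * (\<rho>1 h * \<rho>4 h))"])
      fix r1 r2 r3 r4 :: real assume "r1 + r2 + r3 + r4 = 0"
      then have r4: "r4 = - (r1 + r2 + r3)"
        by simp
      show "(\<rho>1 (combination r1 r2 r3 r4) + \<rho>4 (combination r1 r2 r3 r4)) *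
          (k * (a\<^sup>2 * (\<rho>2 (combination r1 r2 r3 r4) * \<rho>3 (combination r1 r2 r3 r4)) -
            b\<^sup>2 * (\<rho>1 (combination r1 r2 r3 r4) * \<rho>4 (combination r1 r2 r3 r4)))) =
        k * (d\<^sup>2 * r1 * r2 * r3 + r4 * (a\<^sup>2 * r2 * r3 + b\<^sup>2 * r1 * r3 + c\<^sup>2 * r1 * r2))"
        unfolding \<rho> r4 eq by (simp add: algebra_simps)
    qed (simp_all only: \<rho>, (intro intros)+, simp_all)
  qed
qed

text \<open>The products of \<open>q\<close> with the points, divided by \<open>H q P3\<close>, form
  one configuration. The four degenerate side lengths are excluded by
  \<open>no_convex_relation\<close>, with each point in turn in the last place.\<close>

lemma infinite_linkage_if_equidistant:
  assumes q: "Re (H q q) < 0"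
    and n: "norm (H q P1) = 1" "norm (H q P2) = 1" "norm (H q P3) = 1" "norm (H q P4) = 1"
    and \<sigma>: "H P1 P1 = \<sigma>" "H P2 P2 = \<sigma>" "H P3 P3 = \<sigma>" "H P4 P4 = \<sigma>"
  shows "infinite linkage"
proof -
  \<comment> \<open>The points are ordered below so that each exclusion needs only a sum involving
    \<open>P1\<close>.\<close>
  have sums: "P1 + P2 \<noteq> 0" "P1 + P3 \<noteq> 0" "P1 + P4 \<noteq> 0"
  proof -
    show "P1 + P2 \<noteq> 0" "P1 + P3 \<noteq> 0"
      using independent[of 1 1 0] independent[of 1 0 1] by auto
    show "P1 + P4 \<noteq> 0"
    proof
      assume "P1 + P4 = 0"
      then have P4: "P4 = (-1) *s P1"
        by (simp add: add_eq_0_iff)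
      have "complex_of_real (a - d) *s P1 + complex_of_real b *s P2 + complex_of_real c *s P3 = 0"
        using relation unfolding P4 by (simp add: vec_eq_iff algebra_simps)
      then show False
        using independent pos by fastforce
    qed
  qed
  define t where "t = H q P3"
  have "t \<noteq> 0"
    using n by (auto simp: t_def)
  have d4: "- d * H q P4 = a * H q P1 + b * H q P2 + c * H q P3"
    using pos by (simp add: coordinate4)
  have "a * (H q P1 / t) + b * (H q P2 / t) + c = - d * H q P4 / t"
    unfolding d4 using \<open>t \<noteq> 0\<close> by (simp add: add_divide_distrib t_def)
  then have "norm (a * (H q P1 / t) + b * (H q P2 / t) + c) = norm (- d * H q P4 / t)"
    by simp
  also have "\<dots> = d"
    using n pos by (simp add: norm_mult norm_divide t_def)
  finally have "(H q P1 / t, H q P2 / t) \<in> linkage"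
    using n by (simp add: linkage_def norm_divide t_def)
  moreover have "d \<noteq> a + b + c"
    using no_convex_relation[OF q n \<sigma> pos(1-3) relation] sums by simp
  moreover have "a \<noteq> b + c + d"
    using no_convex_relation[OF q n(2,3,4,1) \<sigma>(2,3,4,1) pos(2-4), of a] relation sums
    by (simp add: ac_simps)
  moreover have "b \<noteq> a + c + d"
    using no_convex_relation[OF q n(1,3,4,2) \<sigma>(1,3,4,2) pos(1,3,4), of b] relation sums
    by (simp add: ac_simps)
  moreover have "c \<noteq> a + b + d"
    using no_convex_relation[OF q n(1,2,4,3) \<sigma>(1,2,4,3) pos(1,2,4), of c] relation sums
    by (simp add: ac_simps)
  ultimately show ?thesis
    using infinite_linkage by blast
qed

end

section \<open>Normalising the phases of the points\<close>

lemma (in hermitian_ppm) rank_one_phase: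
  assumes "norm \<omega> = 1"
  shows "rank_one H (\<omega> *s v) (\<omega> *s v) = rank_one H v v"
proof -
  have "\<omega> * cnj \<omega> = 1"
    using assms by (simp add: complex_norm_square[symmetric])
  then have "cnj \<omega> * \<omega> = 1"
    by (simp add: mult.commute)
  then have "(\<lambda>x. H x (\<omega> *s v) *s (\<omega> *s v)) = (\<lambda>x. H x v *s v)"
    by (auto simp: smult_right fun_eq_iff vec_eq_iff)
  then show ?thesis
    by (simp add: rank_one_def)
qed

theorem proposition1p2p10:
  fixes H :: "V \<Rightarrow> V \<Rightarrow> complex" and W :: "endo set"
  assumes "hermitian_form H" and "signature_ppm H"
    and "elliptic_family H W" and "equitant_family H W"
    and "irreducible_cubic W"
  shows "irreducible_algebraic_curve (base H W)"
proof -
  interpret hermitian_ppm H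
    using assms(1,2) by unfold_locales
  obtain p :: "4 \<Rightarrow> V" and \<sigma> :: real and q where
    self': "\<forall>i. p i \<noteq> 0 \<and> H (p i) (p i) = of_real \<sigma>" and
    general': "\<forall>i j k. i \<noteq> j \<longrightarrow> i \<noteq> k \<longrightarrow> j \<noteq> k \<longrightarrow>
           \<not> (\<exists>U. vec.subspace U \<and> vec.dim U = 2 \<and> {p i, p j, p k} \<subseteq> U)" and
    q: "Re (H q q) < 0" "\<forall>i. cmod (H q (p i)) = 1" and
    W: "W = {\<Sum>i\<in>UNIV. r i *\<^sub>R rank_one H (p i) (p i) | r. (\<Sum>i\<in>UNIV. r i) = 0}"
    using assms(4) unfolding equitant_family_def by (elim exE conjE)
  have self: "H (p i) (p i) = of_real \<sigma>" for i
    using self' by simp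
  have general: "\<nexists>U. vec.subspace U \<and> vec.dim U = 2 \<and> {p i, p j, p k} \<subseteq> U"
    if "i \<noteq> j" "i \<noteq> k" "j \<noteq> k" for i j k
    using general'[rule_format, OF that] .
  note ind = general_triple_independent[OF general]
  have ind123: "x = 0 \<and> y = 0 \<and> z = 0" if "x *s p 1 + y *s p 2 + z *s p 3 = 0" for x y z
    by (rule ind[OF _ _ _ that]) simp_all
  obtain r s t where rst: "p 4 = r *s p 1 + s *s p 2 + t *s p 3"
    by (rule independent_triple_spans[OF ind123])
  \<comment> \<open>All terms of the linear relation are moved to one side, hence the coefficient
    \<open>-1\<close>. A zero among \<open>r\<close>, \<open>s\<close>, \<open>t\<close> would leave
    a relation between three of the points.\<close>
  define \<kappa> :: "4 \<Rightarrow> complex" where "\<kappa> i = (if i = 1 then r else if i = 2 then s else if i = 3 then t else -1)" for i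
  have rel: "\<kappa> 1 *s p 1 + \<kappa> 2 *s p 2 + \<kappa> 3 *s p 3 + \<kappa> 4 *s p 4 = 0"
    by (simp add: \<kappa>_def rst)
  have "r \<noteq> 0"
  proof
    assume "r = 0"
    then have "s *s p 2 + t *s p 3 + (-1) *s p 4 = 0"
      by (simp add: rst)
    then have "s = 0 \<and> t = 0 \<and> (-1 :: complex) = 0"
      by (rule ind[rotated 3]) simp_all
    then show False by simp
  qed
  moreover have "s \<noteq> 0"
  proof
    assume "s = 0"
    then have "r *s p 1 + t *s p 3 + (-1) *s p 4 = 0"
      by (simp add: rst)
    then have "r = 0 \<and> t = 0 \<and> (-1 :: complex) = 0"
      by (rule ind[rotated 3]) simp_all
    then show False by simp
  qed
  moreover have "t \<noteq> 0"
  proof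
    assume "t = 0"
    then have "r *s p 1 + s *s p 2 + (-1) *s p 4 = 0"
      by (simp add: rst)
    then have "r = 0 \<and> s = 0 \<and> (-1 :: complex) = 0"
      by (rule ind[rotated 3]) simp_all
    then show False by simp
  qed
  ultimately have \<kappa>0: "\<kappa> i \<noteq> 0" for i
    by (simp add: \<kappa>_def)
  \<comment> \<open>Moving the phase of each coefficient into its point leaves the moduli as sides
    of the quadrilateral and does not change the rank-one operators.\<close>
  define \<omega> where "\<omega> i = \<kappa> i / norm (\<kappa> i)" for i
  have \<omega>1: "norm (\<omega> i) = 1" for i
    using \<kappa>0[of i] by (simp add: \<omega>_def norm_divide)
  define P where "P i = \<omega> i *s p i" for i
  have scale: "complex_of_real (norm (\<kappa> i)) *s P i = \<kappa> i *s p i" for i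
    using \<kappa>0[of i] by (simp add: P_def \<omega>_def)
  interpret equitant_points H "norm (\<kappa> 1)" "norm (\<kappa> 2)" "norm (\<kappa> 3)" "norm (\<kappa> 4)" "P 1" "P 2" "P 3" "P 4"
  proof
    show "norm (\<kappa> 1) > 0" "norm (\<kappa> 2) > 0" "norm (\<kappa> 3) > 0" "norm (\<kappa> 4) > 0"
      using \<kappa>0 by simp_all
    show "complex_of_real (norm (\<kappa> 1)) *s P 1 + complex_of_real (norm (\<kappa> 2)) *s P 2 +
      complex_of_real (norm (\<kappa> 3)) *s P 3 + complex_of_real (norm (\<kappa> 4)) *s P 4 = 0"
      using rel by (simp only: scale)
    fix x y z assume "x *s P 1 + y *s P 2 + z *s P 3 = 0"
    then have "(x * \<omega> 1) *s p 1 + (y * \<omega> 2) *s p 2 + (z * \<omega> 3) *s p 3 = 0"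
      by (simp add: P_def)
    then have "x * \<omega> 1 = 0 \<and> y * \<omega> 2 = 0 \<and> z * \<omega> 3 = 0"
      by (rule ind123)
    moreover have "\<omega> i \<noteq> 0" for i
      using \<omega>1[of i] by auto
    ultimately show "x = 0 \<and> y = 0 \<and> z = 0"
      by simp
  qed
  have rank: "rank_one H (P i) (P i) = rank_one H (p i) (p i)" for i
    unfolding P_def using \<omega>1 by (rule rank_one_phase)
  have "W = family"
  proof (intro subset_antisym subsetI)
    fix h assume "h \<in> W"
    then show "h \<in> family"
      unfolding W family_def by (auto simp: combination_def rank sum_4)
  next
    fix h assume "h \<in> family"
    then obtain r1 r2 r3 r4 where h: "h = combination r1 r2 r3 r4" "r1 + r2 + r3 + r4 = 0"
      unfolding family_def by blast
    define \<rho> :: "4 \<Rightarrow> real" where "\<rho> i = (if i = 1 then r1 else if i = 2 then r2 else if i = 3 then r3 else r4)" for i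
    have "h = (\<Sum>i\<in>UNIV. \<rho> i *\<^sub>R rank_one H (p i) (p i))" "(\<Sum>i\<in>UNIV. \<rho> i) = 0"
      using h by (simp_all add: combination_def rank sum_4 \<rho>_def)
    then show "h \<in> W"
      unfolding W by blast
  qed
  then have "non_kite (norm (\<kappa> 1)) (norm (\<kappa> 2)) (norm (\<kappa> 3)) (norm (\<kappa> 4))"
    using non_kite_if_irreducible assms(5) by simp
  moreover have "infinite linkage"
  proof (rule infinite_linkage_if_equidistant[OF q(1)])
    have "norm (H q (P i)) = 1" "H (P i) (P i) = of_real \<sigma>" for i
    proof -
      show "norm (H q (P i)) = 1"
        using \<omega>1[of i] q(2) by (simp add: P_def smult_right norm_mult)
      have "\<omega> i * cnj (\<omega> i) = 1"
        using \<omega>1[of i] by (simp add: complex_norm_square[symmetric])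
      then have "cnj (\<omega> i) * \<omega> i = 1"
        by (simp add: mult.commute)
      then show "H (P i) (P i) = of_real \<sigma>"
        by (simp add: P_def form_simps self)
    qed
    then show "norm (H q (P 1)) = 1" "norm (H q (P 2)) = 1" "norm (H q (P 3)) = 1" "norm (H q (P 4)) = 1"
      "H (P 1) (P 1) = of_real \<sigma>" "H (P 2) (P 2) = of_real \<sigma>" "H (P 3) (P 3) = of_real \<sigma>" "H (P 4) (P 4) = of_real \<sigma>"
      by blast+
  qed
  ultimately have "irreducible_algebraic_curve equimodular"
    by (rule irreducible_equimodular)
  then show ?thesis
    by (simp add: \<open>W = family\<close> base_family)
qed

end
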